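(* Let $K\subseteq\mathbb{R}^n$ be a centrally symmetric convex body in John's position and let $(c_j,v_j)_{j=1}^m\subseteq(0,1]\times(\partial K\cap S^{n-1})$ be its associated decomposition of the identity. Let $H$ be a $k$-dimensional linear subspace of $\mathbb{R}^n$, let $J=\{1\le j\le m: P_Hv_j\neq0\}$ and, for $j\in J$, let $\tilde c_j=c_j\|P_Hv_j\|_2^2$. Then $$\mathrm{vol}_k(K\cap H)\le\mathrm{vol}_k(B_\infty^k)\prod_{j\in J}\left(\frac{I_{\frac{1}{1-\tilde c_j}}}{\pi\sqrt{1-\tilde c_j}}\right)^{1-\tilde c_j}c_j^{\frac{\tilde c_j}{2}},$$ where, for any $p>1$, $I_p=\int_{\mathbb{R}}\left|\frac{\sin x}{x}\right|^pdx$. If for some $j\in J$ we have $\tilde c_j=1$, then necessarily $c_j=\|P_Hv_j\|_2=1$ and the corresponding factor is understood as $1$.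
   Context: A convex body $K\subseteq\mathbb{R}^n$ is in John's position if the maximal volume ellipsoid contained in $K$ is the Euclidean unit ball $B_2^n$. A centrally symmetric convex body $K$ is in John's position if and only if $B_2^n\subseteq K$ and there exist contact points $v_1,\dots,v_m\in\partial K\cap S^{n-1}$ and $c_1,\dots,c_m\in(0,1]$ with $\mathrm{Id}_n=\sum_{j=1}^mc_j\,v_j\otimes v_j$; such a family $(c_j,v_j)_{j=1}^m$ is called an associated decomposition of the identity. $P_H$ is the orthogonal projection onto $H$, and $B_\infty^k=[-1,1]^k$. *)

theory Defs
  imports "HOL-Analysis.Analysis"
begin

section \<open>Convex bodies and John's position\<close>

definition convex_body :: "'a::euclidean_space set \<Rightarrow> bool" where
  "convex_body K \<longleftrightarrow> convex K \<and> compact K \<and> interior K \<noteq> {}"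

definition centrally_symmetric :: "'a::euclidean_space set \<Rightarrow> bool" where
  "centrally_symmetric K \<longleftrightarrow> uminus ` K = K"

definition ellipsoid :: "'a::euclidean_space set \<Rightarrow> bool" where
  "ellipsoid E \<longleftrightarrow> (\<exists>a (T :: 'a \<Rightarrow> 'a). linear T \<and> inj T \<and> E = (\<lambda>x. a + T x) ` cball 0 1)"

text \<open>Uniqueness of the maximal volume ellipsoid of a convex body is John's theorem,
  so it is not built into the definition.\<close>

definition max_volume_ellipsoid :: "'a::euclidean_space set \<Rightarrow> 'a set \<Rightarrow> bool" where
  "max_volume_ellipsoid K E \<longleftrightarrow> ellipsoid E \<and> E \<subseteq> K \<and>
     (\<forall>F. ellipsoid F \<and> F \<subseteq> K \<longrightarrow> measure lebesgue F \<le> measure lebesgue E)"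

definition john_position :: "'a::euclidean_space set \<Rightarrow> bool" where
  "john_position K \<longleftrightarrow> max_volume_ellipsoid K (cball 0 1)"

definition tensor_square :: "'a::euclidean_space \<Rightarrow> 'a \<Rightarrow> 'a" where
  "tensor_square v = (\<lambda>x. (v \<bullet> x) *\<^sub>R v)"

definition decomposition_of_identity ::
    "'a::euclidean_space set \<Rightarrow> nat \<Rightarrow> (nat \<Rightarrow> real) \<Rightarrow> (nat \<Rightarrow> 'a) \<Rightarrow> bool" where
  "decomposition_of_identity K m c v \<longleftrightarrow>
     (\<forall>j\<in>{1..m}. c j \<in> {0<..1} \<and> v j \<in> frontier K \<inter> sphere 0 1) \<and>
     id = (\<lambda>x. \<Sum>j=1..m. c j *\<^sub>R tensor_square (v j) x)"

section \<open>Orthogonal projection\<close>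

definition orth_proj :: "'a::euclidean_space set \<Rightarrow> 'a \<Rightarrow> 'a" where
  "orth_proj H x = (THE y. y \<in> H \<and> x - y \<in> H\<^sup>\<bottom>)"

lemma orth_proj_unique:
  assumes "subspace H" "y \<in> H" "x - y \<in> H\<^sup>\<bottom>"
  shows "orth_proj H x = y"
  unfolding orth_proj_def
proof (rule the_equality)
  fix z assume z: "z \<in> H \<and> x - z \<in> H\<^sup>\<bottom>"
  then have 1: "z - y \<in> H" using assms by (simp add: subspace_diff)
  have "(x - y) - (x - z) \<in> H\<^sup>\<bottom>"
    using assms z subspace_diff[OF subspace_orthogonal_comp] by blast
  then have "z - y \<in> H\<^sup>\<bottom>" by simp
  with 1 have "(z - y) \<bullet> (z - y) = 0"
    unfolding orthogonal_comp_def orthogonal_def by blast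
  then show "z = y" by simp
qed (use assms in simp)

lemma orth_proj_exists:
  assumes "subspace H"
  shows "orth_proj H x \<in> H" "x - orth_proj H x \<in> H\<^sup>\<bottom>"
proof -
  obtain y z where "y \<in> H" "z \<in> H\<^sup>\<bottom>" "x = y + z"
    using subspace_sum_orthogonal_comp[OF assms] set_plus_elim by blast
  moreover from this have "orth_proj H x = y"
    using assms by (intro orth_proj_unique) auto
  ultimately show "orth_proj H x \<in> H" "x - orth_proj H x \<in> H\<^sup>\<bottom>" by auto
qed

section \<open>Volume on a linear subspace\<close>

definition orthonormal_basis_of :: "'a::euclidean_space set \<Rightarrow> 'a set \<Rightarrow> bool" where
  "orthonormal_basis_of H B \<longleftrightarrow>
     B \<subseteq> H \<and> pairwise orthogonal B \<and> (\<forall>b\<in>B. norm b = 1) \<and> span B = H"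

text \<open>The Lebesgue measure carried by the span of an orthonormal set \<open>B\<close>, as a measure on the
  Borel sets of the ambient space; \<^term>\<open>lborel_onb Basis\<close> is \<^const>\<open>lborel\<close>.\<close>

definition lborel_onb :: "'a::euclidean_space set \<Rightarrow> 'a measure" where
  "lborel_onb B = distr (\<Pi>\<^sub>M b\<in>B. (lborel :: real measure)) borel (\<lambda>f. \<Sum>b\<in>B. f b *\<^sub>R b)"

text \<open>The choice of the orthonormal basis is irrelevant: see \<open>subspace_lborel_eq\<close> below.\<close>

definition subspace_lborel :: "'a::euclidean_space set \<Rightarrow> 'a measure" where
  "subspace_lborel H = lborel_onb (SOME B. orthonormal_basis_of H B)"

definition subspace_vol :: "'a::euclidean_space set \<Rightarrow> 'a set \<Rightarrow> real" where
  "subspace_vol H A = measure (subspace_lborel H) A"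

lemma orthonormal_basis_of_finite:
  assumes "orthonormal_basis_of H B" shows "finite B" "card B = dim H" "independent B"
proof -
  have "0 \<notin> B" using assms by (auto simp: orthonormal_basis_of_def)
  then show i: "independent B"
    using assms pairwise_orthogonal_independent by (auto simp: orthonormal_basis_of_def)
  then show "finite B" by (rule independent_imp_finite)
  show "card B = dim H" using i assms
    by (metis dim_span_eq_card_independent orthonormal_basis_of_def)
qed

lemma orthonormal_basis_of_exists:
  assumes "subspace H" shows "\<exists>B. orthonormal_basis_of H B"
  using orthonormal_basis_subspace[OF assms] unfolding orthonormal_basis_of_def by metis

lemma inner_sum_orthonormal:
  assumes "finite B" "pairwise orthogonal B" "\<forall>b\<in>B. norm b = 1" "d \<in> B"
  shows "d \<bullet> (\<Sum>b\<in>B. f b *\<^sub>R b) = f d"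
proof -
  have "d \<bullet> (\<Sum>b\<in>B. f b *\<^sub>R b) = (\<Sum>b\<in>B. f b * (d \<bullet> b))"
    by (simp add: inner_sum_right)
  also have "\<dots> = (\<Sum>b\<in>B. if b = d then f b else 0)"
    using assms by (intro sum.cong) (auto simp: pairwise_def orthogonal_def norm_eq_1)
  finally show ?thesis using assms by simp
qed

lemma lborel_distr_translate: "distr lborel borel (\<lambda>x. x + a) = (lborel :: 'a::euclidean_space measure)"
  using lborel_distr_plus[of a] by (simp add: add.commute[of _ a] cong: distr_cong)

lemma nn_integral_translate_lborel:
  fixes a :: "'a::euclidean_space"
  assumes [measurable]: "f \<in> borel_measurable borel"
  shows "(\<integral>\<^sup>+x. f (x + a) \<partial>lborel) = (\<integral>\<^sup>+x. f x \<partial>lborel)"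
  by (subst (2) lborel_distr_translate[of a, symmetric]) (simp add: nn_integral_distr)

lemma lborel_distr_norm_preserving:
  fixes T :: "'a::euclidean_space \<Rightarrow> 'a"
  assumes T: "linear T" and n: "\<And>x. norm (T x) = norm x"
  shows "distr lborel borel T = lborel"
proof -
  have cT: "continuous_on UNIV T" using T linear_continuous_on linear_conv_bounded_linear by blast
  then have [measurable]: "T \<in> borel_measurable borel" by (rule borel_measurable_continuous_onI)
  have "inj T"
    using T n by (metis linear_inj_iff_eq_0 norm_eq_zero)
  then have sT: "surj T" using T by (simp add: linear_injective_imp_surjective)
  let ?C = "cball 0 1 :: 'a set"
  have C: "emeasure lborel ?C \<noteq> \<infinity>"
    using emeasure_bounded_finite[of ?C] by simp
  have "0 < measure lborel ?C"
    using content_cball_pos[of 1 "0::'a"] by (simp add: measure_completion)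
  then have C0: "emeasure lborel ?C \<noteq> 0" by (auto simp: measure_def)
  show ?thesis
  proof (rule measure_eqI)
    fix A assume "A \<in> sets (distr lborel borel T)"
    then have [measurable]: "A \<in> sets borel" by simp
    let ?f = "indicator ?C :: 'a \<Rightarrow> ennreal" and ?g = "indicator A :: 'a \<Rightarrow> ennreal"
    have [measurable]: "?C \<in> sets borel" by simp
    have inv: "(\<integral>\<^sup>+y. ?g (T y + x) \<partial>lborel) = (\<integral>\<^sup>+y. ?g (T y) \<partial>lborel)" for x
    proof -
      obtain z where z: "x = T z" using sT by (metis surjD)
      have "(\<integral>\<^sup>+y. ?g (T y + x) \<partial>lborel) = (\<integral>\<^sup>+y. ?g (T (y + z)) \<partial>lborel)"
        using T z by (simp add: linear_add)
      also have "\<dots> = (\<integral>\<^sup>+y. ?g (T y) \<partial>lborel)"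
        by (rule nn_integral_translate_lborel) measurable
      finally show ?thesis .
    qed
    have symf: "?f (x - T y) = ?f (T y - x)" for x y
      by (auto simp: indicator_def norm_minus_commute)
    have invf: "(\<integral>\<^sup>+y. ?f (x - T y) \<partial>lborel) = emeasure lborel ?C" for x
    proof -
      obtain z where z: "- x = T z" using sT by (metis surjD)
      have "(\<integral>\<^sup>+y. ?f (x - T y) \<partial>lborel) = (\<integral>\<^sup>+y. ?f (T (y + z)) \<partial>lborel)"
        unfolding symf using T z by (simp add: linear_add flip: z)
      also have "\<dots> = (\<integral>\<^sup>+y. ?f (T y) \<partial>lborel)"
        by (rule nn_integral_translate_lborel) measurable
      also have "\<dots> = (\<integral>\<^sup>+y. ?f y \<partial>lborel)"
        by (simp add: indicator_def n)
      finally show ?thesis by simp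
    qed
    have e: "emeasure (distr lborel borel T) A = (\<integral>\<^sup>+y. ?g (T y) \<partial>lborel)"
      using nn_integral_distr[of T lborel borel ?g] by simp
    have "emeasure lborel ?C * emeasure (distr lborel borel T) A
        = (\<integral>\<^sup>+x. ?f x * (\<integral>\<^sup>+y. ?g (T y) \<partial>lborel) \<partial>lborel)"
      unfolding e by (subst nn_integral_multc) auto
    also have "\<dots> = (\<integral>\<^sup>+x. (\<integral>\<^sup>+y. ?f x * ?g (T y + x) \<partial>lborel) \<partial>lborel)"
      by (subst nn_integral_cmult) (auto simp: inv)
    also have "\<dots> = (\<integral>\<^sup>+y. (\<integral>\<^sup>+x. ?f x * ?g (T y + x) \<partial>lborel) \<partial>lborel)"
      by (rule lborel_pair.Fubini'[symmetric]) measurable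
    also have "\<dots> = (\<integral>\<^sup>+y. (\<integral>\<^sup>+x. ?f (x - T y) * ?g x \<partial>lborel) \<partial>lborel)"
    proof (rule nn_integral_cong)
      fix y
      have "(\<integral>\<^sup>+x. ?f ((x + T y) - T y) * ?g (x + T y) \<partial>lborel)
          = (\<integral>\<^sup>+x. ?f (x - T y) * ?g x \<partial>lborel)"
        by (rule nn_integral_translate_lborel) measurable
      then show "(\<integral>\<^sup>+x. ?f x * ?g (T y + x) \<partial>lborel) = (\<integral>\<^sup>+x. ?f (x - T y) * ?g x \<partial>lborel)"
        by (simp add: add.commute)
    qed
    also have "\<dots> = (\<integral>\<^sup>+x. (\<integral>\<^sup>+y. ?f (x - T y) * ?g x \<partial>lborel) \<partial>lborel)"
      by (rule lborel_pair.Fubini') measurable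
    also have "\<dots> = (\<integral>\<^sup>+x. emeasure lborel ?C * ?g x \<partial>lborel)"
      by (subst nn_integral_multc) (auto simp: invf)
    also have "\<dots> = emeasure lborel ?C * emeasure lborel A"
      by (subst nn_integral_cmult) auto
    finally show "emeasure (distr lborel borel T) A = emeasure lborel A"
      using C C0 by (simp add: ennreal_mult_cancel_left)
  qed simp
qed

interpretation lb: product_sigma_finite "\<lambda>_. lborel :: real measure"
  by unfold_locales

lemma lborel_onb_full:
  fixes D :: "'a::euclidean_space set"
  assumes D: "orthonormal_basis_of UNIV D"
  shows "lborel_onb D = lborel"
proof -
  have fin: "finite D" and card: "card D = card (Basis :: 'a set)"
    using orthonormal_basis_of_finite[OF D] by auto
  obtain g where g: "bij_betw g D (Basis :: 'a set)"
    using fin card finite_Basis finite_same_card_bij by blast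
  define T :: "'a \<Rightarrow> 'a" where "T x = (\<Sum>d\<in>D. (x \<bullet> g d) *\<^sub>R d)" for x
  have gB: "g d \<in> Basis" if "d \<in> D" for d using g that by (auto simp: bij_betw_def)
  have "linear T"
    unfolding T_def by (intro linearI) (auto simp: inner_add_left scaleR_add_left sum.distrib scaleR_sum_right)
  moreover have "norm (T x) = norm x" for x
  proof -
    have "T x \<bullet> T x = (\<Sum>d\<in>D. (x \<bullet> g d) * (d \<bullet> T x))"
      by (subst (1) T_def) (simp add: inner_sum_left)
    also have "\<dots> = (\<Sum>d\<in>D. (x \<bullet> g d) * (x \<bullet> g d))"
      using D fin unfolding T_def orthonormal_basis_of_def
      by (intro sum.cong refl arg_cong2[where f="(*)"] inner_sum_orthonormal) auto
    also have "\<dots> = (\<Sum>b\<in>Basis. (x \<bullet> b) * (x \<bullet> b))"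
      using sum.reindex_bij_betw[OF g, of "\<lambda>b. (x \<bullet> b) * (x \<bullet> b)"] .
    also have "\<dots> = x \<bullet> x" by (rule euclidean_inner[symmetric])
    finally show ?thesis by (simp add: norm_eq_sqrt_inner)
  qed
  ultimately have T: "distr lborel borel T = lborel" by (rule lborel_distr_norm_preserving)
  have [measurable]: "T \<in> borel_measurable borel"
    using \<open>linear T\<close> linear_continuous_on linear_conv_bounded_linear borel_measurable_continuous_onI by blast
  let ?r = "\<lambda>f. \<lambda>d\<in>D. f (g d)"
  let ?PB = "\<Pi>\<^sub>M b\<in>(Basis :: 'a set). (lborel :: real measure)"
  let ?PD = "\<Pi>\<^sub>M b\<in>D. (lborel :: real measure)"
  have rm[measurable]: "?r \<in> measurable ?PB ?PD"
    using gB by (intro measurable_restrict measurable_component_singleton)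
  have "distr ?PB ?PD ?r = ?PD"
  proof (rule lb.PiM_eqI[OF fin])
    fix A :: "'a \<Rightarrow> real set" assume A: "\<And>i. i \<in> D \<Longrightarrow> A i \<in> sets lborel"
    let ?A = "\<lambda>b. A (the_inv_into D g b)"
    have inj: "inj_on g D" and im: "g ` D = Basis" using g by (auto simp: bij_betw_def)
    have AB: "?A b \<in> sets lborel" if "b \<in> Basis" for b
      using A the_inv_into_into[OF inj, of b D] im that by auto
    have "?r -` Pi\<^sub>E D A \<inter> space ?PB = Pi\<^sub>E Basis ?A"
    proof (intro equalityI subsetI)
      fix f assume f: "f \<in> ?r -` Pi\<^sub>E D A \<inter> space ?PB"
      show "f \<in> Pi\<^sub>E Basis ?A"
      proof (rule PiE_I)
        fix b :: 'a assume "b \<in> Basis"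
        then obtain d where d: "d \<in> D" "b = g d" using im by auto
        then show "f b \<in> ?A b" using f inj by (auto simp: the_inv_into_f_f PiE_iff)
      next
        fix b :: 'a assume "b \<notin> Basis"
        then show "f b = undefined" using f by (auto simp: space_PiM PiE_iff extensional_def)
      qed
    next
      fix f assume f: "f \<in> Pi\<^sub>E Basis ?A"
      then have "f (g d) \<in> A d" if "d \<in> D" for d
        using that gB[OF that] inj by (auto simp: PiE_iff the_inv_into_f_f dest!: bspec[of _ _ "g d"])
      then show "f \<in> ?r -` Pi\<^sub>E D A \<inter> space ?PB"
        using f by (auto simp: space_PiM PiE_iff)
    qed
    moreover have "Pi\<^sub>E D A \<in> sets ?PD"
      using A fin by (intro sets_PiM_I_finite) auto
    ultimately have "emeasure (distr ?PB ?PD ?r) (Pi\<^sub>E D A) = emeasure ?PB (Pi\<^sub>E Basis ?A)"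
      by (simp add: emeasure_distr)
    also have "\<dots> = (\<Prod>b\<in>Basis. emeasure lborel (?A b))"
      using AB by (intro lb.emeasure_PiM) auto
    also have "\<dots> = (\<Prod>d\<in>D. emeasure lborel (?A (g d)))"
      using prod.reindex_bij_betw[OF g, of "\<lambda>b. emeasure lborel (?A b)"] by simp
    also have "\<dots> = (\<Prod>d\<in>D. emeasure lborel (A d))"
      using inj by (intro prod.cong) (auto simp: the_inv_into_f_f)
    finally show "emeasure (distr ?PB ?PD ?r) (Pi\<^sub>E D A) = (\<Prod>d\<in>D. emeasure lborel (A d))" .
  qed simp
  then have "lborel_onb D = distr (distr ?PB ?PD ?r) borel (\<lambda>f. \<Sum>b\<in>D. f b *\<^sub>R b)"
    by (simp add: lborel_onb_def)
  also have "\<dots> = distr ?PB borel ((\<lambda>f. \<Sum>b\<in>D. f b *\<^sub>R b) \<circ> ?r)"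
    by (rule distr_distr) measurable
  also have "\<dots> = distr ?PB borel (T \<circ> (\<lambda>f. \<Sum>b\<in>Basis. f b *\<^sub>R b))"
  proof (rule distr_cong)
    fix f
    have "(\<Sum>b\<in>D. ?r f b *\<^sub>R b) = T (\<Sum>b\<in>Basis. f b *\<^sub>R b)"
      unfolding T_def using gB by (intro sum.cong) auto
    then show "((\<lambda>f. \<Sum>b\<in>D. f b *\<^sub>R b) \<circ> ?r) f = (T \<circ> (\<lambda>f. \<Sum>b\<in>Basis. f b *\<^sub>R b)) f"
      by simp
  qed auto
  also have "\<dots> = distr (distr ?PB borel (\<lambda>f. \<Sum>b\<in>Basis. f b *\<^sub>R b)) borel T"
    by (rule distr_distr[symmetric]) measurable
  also have "distr ?PB borel (\<lambda>f. \<Sum>b\<in>Basis. f b *\<^sub>R b) = lborel"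
    by (rule lborel_eq[symmetric])
  finally show ?thesis using T by simp
qed

lemma emeasure_lborel_onb:
  fixes B C :: "'a::euclidean_space set"
  assumes B: "orthonormal_basis_of H B" and C: "orthonormal_basis_of (H\<^sup>\<bottom>) C"
    and A[measurable]: "A \<in> sets borel" and H: "subspace H"
  shows "emeasure (lborel_onb B) A =
    emeasure lborel {x. x - (\<Sum>d\<in>C. (d \<bullet> x) *\<^sub>R d) \<in> A \<and> (\<forall>d\<in>C. d \<bullet> x \<in> {0..1})}"
proof -
  have fB: "finite B" and fC: "finite C"
    using orthonormal_basis_of_finite B C by blast+
  have BC: "orthogonal b d" if "b \<in> B" "d \<in> C" for b d
    using B C that unfolding orthonormal_basis_of_def orthogonal_comp_def by blast
  have dis: "B \<inter> C = {}"
  proof (rule ccontr)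
    assume "B \<inter> C \<noteq> {}"
    then obtain b where "b \<in> B" "b \<in> C" by blast
    then have "b = 0" using BC orthogonal_self by blast
    then show False using B \<open>b \<in> B\<close> by (auto simp: orthonormal_basis_of_def)
  qed
  let ?D = "B \<union> C"
  have D: "orthonormal_basis_of UNIV ?D"
  proof -
    have "pairwise orthogonal ?D"
      using B C BC unfolding orthonormal_basis_of_def pairwise_def by (metis Un_iff orthogonal_commute)
    moreover have "span ?D = UNIV"
    proof -
      have "x \<in> span ?D" for x
      proof -
        obtain y z where "y \<in> H" "z \<in> H\<^sup>\<bottom>" "x = y + z"
          using subspace_sum_orthogonal_comp[OF H] set_plus_elim by blast
        then have "y \<in> span B" "z \<in> span C"
          using B C by (simp_all add: orthonormal_basis_of_def)
        then show ?thesis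
          unfolding \<open>x = y + z\<close> by (meson span_add span_mono subsetD sup_ge1 sup_ge2)
      qed
      then show ?thesis by blast
    qed
    ultimately show ?thesis using B C by (auto simp: orthonormal_basis_of_def)
  qed
  let ?E = "{x. x - (\<Sum>d\<in>C. (d \<bullet> x) *\<^sub>R d) \<in> A \<and> (\<forall>d\<in>C. d \<bullet> x \<in> {0..1})}"
  let ?P = "\<lambda>I. \<Pi>\<^sub>M b\<in>I. (lborel :: real measure)"
  let ?s = "\<lambda>I f. \<Sum>b\<in>I. f b *\<^sub>R b :: 'a"
  have E: "?E \<in> sets borel"
  proof -
    let ?p = "\<lambda>x. x - (\<Sum>d\<in>C. (d \<bullet> x) *\<^sub>R d)"
    have "?p -` A \<in> sets borel" by (rule measurable_sets_borel[OF _ A]) measurable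
    moreover have "closed (\<Inter>d\<in>C. (\<lambda>x. d \<bullet> x) -` {0..1})"
      by (intro closed_INT ballI closed_vimage continuous_intros)
    ultimately have "?p -` A \<inter> (\<Inter>d\<in>C. (\<lambda>x. d \<bullet> x) -` {0..1}) \<in> sets borel"
      using borel_closed by blast
    also have "?p -` A \<inter> (\<Inter>d\<in>C. (\<lambda>x. d \<bullet> x) -` {0..1}) = ?E" by auto
    finally show ?thesis .
  qed
  have sm[measurable]: "?s I \<in> measurable (?P I) borel" for I by measurable
  have [measurable]: "merge B C \<in> measurable (?P B \<Otimes>\<^sub>M ?P C) (?P ?D)" by (rule measurable_merge)
  interpret FB: finite_product_sigma_finite "\<lambda>_. lborel :: real measure" B by standard (rule fB)
  interpret FC: finite_product_sigma_finite "\<lambda>_. lborel :: real measure" C by standard (rule fC)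
  have "emeasure lborel ?E = emeasure (lborel_onb ?D) ?E"
    using lborel_onb_full[OF D] by simp
  also have "\<dots> = emeasure (distr (?P B \<Otimes>\<^sub>M ?P C) (?P ?D) (merge B C)) (?s ?D -` ?E \<inter> space (?P ?D))"
    unfolding lborel_onb_def lb.distr_merge[OF dis fB fC] using E by (rule emeasure_distr[OF sm])
  also have "\<dots> = emeasure (?P B \<Otimes>\<^sub>M ?P C)
      (merge B C -` (?s ?D -` ?E \<inter> space (?P ?D)) \<inter> space (?P B \<Otimes>\<^sub>M ?P C))"
    by (intro emeasure_distr measurable_merge measurable_sets[OF sm E])
  also have "merge B C -` (?s ?D -` ?E \<inter> space (?P ?D)) \<inter> space (?P B \<Otimes>\<^sub>M ?P C)
      = (?s B -` A \<inter> space (?P B)) \<times> Pi\<^sub>E C (\<lambda>_. {0..1})"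
  proof -
    have key: "merge B C (f, h) \<in> ?s ?D -` ?E \<inter> space (?P ?D) \<longleftrightarrow>
        ?s B f \<in> A \<and> h \<in> Pi\<^sub>E C (\<lambda>_. {0..1})"
      if f: "f \<in> space (?P B)" and h: "h \<in> space (?P C)" for f h
    proof -
      let ?m = "merge B C (f, h)"
      have m: "?m \<in> space (?P ?D)"
        by (auto simp: space_PiM PiE_iff)
      have sD: "?s ?D ?m = ?s B f + ?s C h"
      proof -
        have "?s ?D ?m = ?s B ?m + ?s C ?m"
          using fB fC dis by (rule sum.union_disjoint)
        also have "?s B ?m = ?s B f" by (intro sum.cong) (auto simp: merge_def)
        also have "?s C ?m = ?s C h" using dis by (intro sum.cong) (auto simp: merge_def)
        finally show ?thesis .
      qed
      have dc: "d \<bullet> ?s ?D ?m = h d" if "d \<in> C" for d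
      proof -
        have "d \<bullet> ?s ?D ?m = ?m d"
          using D fB fC that by (intro inner_sum_orthonormal) (auto simp: orthonormal_basis_of_def)
        then show ?thesis using that dis by (auto simp: merge_def)
      qed
      have "?s ?D ?m - (\<Sum>d\<in>C. (d \<bullet> ?s ?D ?m) *\<^sub>R d) = ?s B f"
        using dc by (simp add: sD)
      then show ?thesis using m dc h by (auto simp: space_PiM PiE_iff)
    qed
    define X where "X = ?s ?D -` ?E \<inter> space (?P ?D)"
    define Y where "Y = Pi\<^sub>E C (\<lambda>_. {0..1::real})"
    have Y: "Y \<subseteq> space (?P C)" by (auto simp: Y_def space_PiM)
    note key' = key[folded X_def Y_def]
    have "merge B C -` X \<inter> space (?P B \<Otimes>\<^sub>M ?P C) = (?s B -` A \<inter> space (?P B)) \<times> Y"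
    proof (rule set_eqI)
      fix p :: "('a \<Rightarrow> real) \<times> ('a \<Rightarrow> real)"
      obtain f h where p: "p = (f, h)" by fastforce
      show "p \<in> merge B C -` X \<inter> space (?P B \<Otimes>\<^sub>M ?P C) \<longleftrightarrow> p \<in> (?s B -` A \<inter> space (?P B)) \<times> Y"
        using key'[of f h] Y unfolding p space_pair_measure by blast
    qed
    then show ?thesis unfolding X_def Y_def .
  qed
  also have "emeasure (?P B \<Otimes>\<^sub>M ?P C) ((?s B -` A \<inter> space (?P B)) \<times> Pi\<^sub>E C (\<lambda>_. {0..1}))
      = emeasure (?P B) (?s B -` A \<inter> space (?P B)) * emeasure (?P C) (Pi\<^sub>E C (\<lambda>_. {0..1}))"
    using fC by (intro FC.emeasure_pair_measure_Times measurable_sets[OF sm A] sets_PiM_I_finite) auto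
  also have "emeasure (?P C) (Pi\<^sub>E C (\<lambda>_. {0..1})) = 1"
    using fC by (subst lb.emeasure_PiM) auto
  also have "emeasure (?P B) (?s B -` A \<inter> space (?P B)) = emeasure (lborel_onb B) A"
    unfolding lborel_onb_def by (rule emeasure_distr[symmetric]) measurable
  finally show ?thesis by simp
qed

lemma lborel_onb_unique:
  assumes "orthonormal_basis_of H B" "orthonormal_basis_of H B'"
  shows "lborel_onb B = lborel_onb B'"
proof -
  have H: "subspace H" using assms(1) subspace_span unfolding orthonormal_basis_of_def by metis
  obtain C where C: "orthonormal_basis_of (H\<^sup>\<bottom>) C"
    using orthonormal_basis_of_exists[OF subspace_orthogonal_comp] by blast
  show ?thesis
  proof (rule measure_eqI)
    show "sets (lborel_onb B) = sets (lborel_onb B')" by (simp add: lborel_onb_def)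
    fix A assume "A \<in> sets (lborel_onb B)"
    then have "A \<in> sets borel" by (simp add: lborel_onb_def)
    then show "emeasure (lborel_onb B) A = emeasure (lborel_onb B') A"
      using assms C H by (simp add: emeasure_lborel_onb)
  qed
qed

lemma subspace_lborel_eq:
  assumes "orthonormal_basis_of H B"
  shows "subspace_lborel H = lborel_onb B"
  unfolding subspace_lborel_def using someI[of "orthonormal_basis_of H", OF assms] assms
  by (rule lborel_onb_unique)

section \<open>The cube and the sinc integral\<close>

text \<open>Points of the cube \<open>[-1,1]^k\<close> and of its ambient space are functions on \<^term>\<open>{..<k}\<close>,
  since \<open>k\<close> is a natural number rather than a type.\<close>

definition cube :: "nat \<Rightarrow> (nat \<Rightarrow> real) set" where
  "cube k = (\<Pi>\<^sub>E i\<in>{..<k}. {-1..1})"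

definition cube_vol :: "nat \<Rightarrow> real" where
  "cube_vol k = measure (\<Pi>\<^sub>M i\<in>{..<k}. (lborel :: real measure)) (cube k)"

text \<open>The value of the integrand at \<open>0\<close> (which is \<open>0\<close> here) does not affect the integral.\<close>

definition sinc_integral :: "real \<Rightarrow> real" where
  "sinc_integral p = (\<integral>x. \<bar>sin x / x\<bar> powr p \<partial>lborel)"

end

theory Submission
  imports Defs "HOL-Probability.Probability"
begin

text \<open>At a contact point \<open>v\<^sub>j\<close> the tangent hyperplane of the unit ball is the only hyperplane supporting \<open>K\<close>, so
the symmetric body \<open>K\<close> lies in every slab \<open>\<bar>v\<^sub>j \<bullet> x\<bar> \<le> 1\<close>. By the decomposition of the identity, \<open>x \<mapsto> (sqrt (c\<^sub>j) (v\<^sub>j \<bullet> x))\<^sub>j\<close> with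
\<open>j \<in> J\<close> maps \<open>H\<close> isometrically onto a \<open>k\<close>-dimensional subspace \<open>E\<close> of \<open>\<real>\<^sup>N\<close>, \<open>N = card J\<close>, and \<open>K \<inter> H\<close> into
the section of a box with half-widths \<open>a\<^sub>j = sqrt (c\<^sub>j)\<close> by \<open>E\<close>. The projections of the unit vector \<open>e\<^sub>j\<close> to \<open>E\<close>
and to its orthogonal complement \<open>F\<close> have squared norms \<open>ct j\<close> and \<open>r\<^sub>j = 1 - ct j\<close>.

Fourier inversion writes the volume of this section as an oscillatory integral of the transform
of the box over \<open>F\<close>, whence it is at most \<open>(2\<pi>)\<^sup>k\<^sup>-\<^sup>N\<close> times the integral over \<open>F\<close> of the product of
\<open>2 a\<^sub>j \<bar>sinc (a\<^sub>j y\<^sub>j)\<bar>\<close> (\<open>gaussian_slab_Fourier_bound\<close>, with a Gaussian cut-off for convergence). Since \<open>y\<^sub>j\<close> is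
\<open>sqrt r\<^sub>j\<close> times the inner product of \<open>y\<close> with a unit vector \<open>u\<^sub>j\<close> of \<open>F\<close>, and the \<open>u\<^sub>j\<close> with \<open>r\<^sub>j > 0\<close>, taken with
weights \<open>r\<^sub>j\<close>, decompose the identity of \<open>F\<close>, the geometric Brascamp-Lieb inequality
(\<open>geometric_Brascamp_Lieb\<close>) bounds that integral by the product of the \<open>r\<^sub>j\<close>-th powers of the integrals of
\<open>\<bar>sinc (a\<^sub>j sqrt r\<^sub>j s)\<bar> powr (1 / r\<^sub>j)\<close>. These are the sinc integrals of the theorem, and \<open>k = N - sum r\<^sub>j\<close>
collects the powers of 2, \<open>\<pi>\<close> and \<open>a\<^sub>j\<close>.

The Brascamp-Lieb inequality is proved by Barthe's transport argument. Each \<open>f\<^sub>j\<close> is the pull-back of a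
multiple of the Gaussian density under an increasing map \<open>T\<^sub>j\<close>; the map \<open>\<Theta> y = sum d\<^sub>j T\<^sub>j (u\<^sub>j \<bullet> y) u\<^sub>j\<close> is injective,
the squared norm of \<open>\<Theta> y\<close> is at most the sum of the \<open>d\<^sub>j (T\<^sub>j (u\<^sub>j \<bullet> y))\<^sup>2\<close>, and the Jacobian of \<open>\<Theta>\<close> dominates the
product of the \<open>d\<^sub>j\<close>-th powers of the derivatives \<open>T\<^sub>j'\<close> by \<open>Ball_det_inequality\<close>. Thus the integrand is at most a
constant times the Gaussian pulled back under \<open>\<Theta>\<close>, and a change of variables gives the bound.

The change of variables takes place in a Euclidean space whose dimension is the cardinality of an
index type, whereas \<open>N\<close> ranges over all natural numbers. To reconcile the two, the bound is stated for matrices with natural number indices (\<open>slice_bound\<close>), and a type is defined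
whose cardinality is a dimension where this statement fails, if there is one.\<close>

section \<open>Orthonormal coordinates\<close>

lemma coordinate_of_sum:
  assumes "orthonormal_basis_of H D" "d \<in> D"
  shows "d \<bullet> (\<Sum>b\<in>D. f b *\<^sub>R b) = f d"
  using assms orthonormal_basis_of_finite[OF assms(1)]
  by (intro inner_sum_orthonormal) (auto simp: orthonormal_basis_of_def)

lemma orthonormal_basis_of_Basis: "orthonormal_basis_of UNIV (Basis :: 'a::euclidean_space set)"
  by (auto simp: orthonormal_basis_of_def pairwise_def orthogonal_def inner_Basis)

lemma orthonormal_basis_Parseval:
  assumes B: "orthonormal_basis_of UNIV B"
  shows "(\<Sum>b\<in>B. (b \<bullet> x)\<^sup>2) = x \<bullet> (x :: 'a::euclidean_space)"
proof -
  have fB: "finite B" using orthonormal_basis_of_finite[OF B] by simp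
  have "x \<in> span B" using B by (simp add: orthonormal_basis_of_def)
  then obtain f where f: "x = (\<Sum>b\<in>B. f b *\<^sub>R b)"
    by (auto simp: span_finite[OF fB])
  have "x \<bullet> x = (\<Sum>b\<in>B. f b * (b \<bullet> x))"
    by (subst (1) f) (simp add: inner_sum_left)
  also have "\<dots> = (\<Sum>b\<in>B. (b \<bullet> x)\<^sup>2)"
    unfolding f using B by (intro sum.cong) (auto simp: coordinate_of_sum power2_eq_square)
  finally show ?thesis by simp
qed

lemma orthonormal_basis_of_complement:
  assumes B: "pairwise orthogonal B" "\<forall>b\<in>B. norm b = 1"
  obtains C :: "'a::euclidean_space set" where "orthonormal_basis_of UNIV (B \<union> C)" "B \<inter> C = {}"
proof -
  let ?H = "span B"
  obtain C where C: "orthonormal_basis_of (?H\<^sup>\<bottom>) C"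
    using orthonormal_basis_of_exists[OF subspace_orthogonal_comp] by blast
  have BC: "orthogonal b d" if "b \<in> B" "d \<in> C" for b d
    using C that span_base[OF that(1)] unfolding orthonormal_basis_of_def orthogonal_comp_def by blast
  have "B \<inter> C = {}"
  proof (rule ccontr)
    assume "B \<inter> C \<noteq> {}"
    then obtain b where "b \<in> B" "b \<in> C" by blast
    then have "b = 0" using BC orthogonal_self by blast
    then show False using B \<open>b \<in> B\<close> by auto
  qed
  moreover have "orthonormal_basis_of UNIV (B \<union> C)"
  proof -
    have "pairwise orthogonal (B \<union> C)"
      using B C BC unfolding orthonormal_basis_of_def pairwise_def by (metis Un_iff orthogonal_commute)
    moreover have "x \<in> span (B \<union> C)" for x
    proof -
      obtain y z where "y \<in> ?H" "z \<in> ?H\<^sup>\<bottom>" "x = y + z"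
        using subspace_sum_orthogonal_comp[OF subspace_span, of B] by (metis UNIV_I set_plus_elim)
      then have "y \<in> span B" "z \<in> span C" using C by (auto simp: orthonormal_basis_of_def)
      then show ?thesis
        unfolding \<open>x = y + z\<close> by (meson span_add span_mono subsetD sup_ge1 sup_ge2)
    qed
    ultimately show ?thesis using B C by (auto simp: orthonormal_basis_of_def)
  qed
  ultimately show ?thesis using that by blast
qed

lemma lborel_eq_distr_coordinates:
  fixes D :: "'a::euclidean_space set"
  assumes "orthonormal_basis_of UNIV D"
  shows "lborel = distr (\<Pi>\<^sub>M b\<in>D. (lborel :: real measure)) borel (\<lambda>f. \<Sum>b\<in>D. f b *\<^sub>R b)"
  using lborel_onb_full[OF assms] by (simp add: lborel_onb_def)

lemma
  fixes D :: "'a::euclidean_space set"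
    and h :: "'a \<Rightarrow> real \<Rightarrow> 'b::{real_normed_field,banach,second_countable_topology}"
  assumes D: "orthonormal_basis_of UNIV D" and h: "\<And>d. d \<in> D \<Longrightarrow> integrable lborel (h d)"
  shows integrable_coordinate_prod: "integrable lborel (\<lambda>x. \<Prod>d\<in>D. h d (d \<bullet> x))"
    and integral_coordinate_prod:
      "(\<integral>x. (\<Prod>d\<in>D. h d (d \<bullet> x)) \<partial>lborel) = (\<Prod>d\<in>D. \<integral>t. h d t \<partial>lborel)"
proof -
  have m: "(\<lambda>x. h d (d \<bullet> x)) \<in> borel_measurable borel" if "d \<in> D" for d
    by (rule measurable_compose[of _ _ borel]) (use h[OF that] in \<open>auto dest: borel_measurable_integrable\<close>)
  then have m': "(\<lambda>x. \<Prod>d\<in>D. h d (d \<bullet> x)) \<in> borel_measurable borel" by measurable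
  have s: "(\<lambda>f. \<Sum>b\<in>D. f b *\<^sub>R b) \<in> measurable (\<Pi>\<^sub>M b\<in>D. (lborel :: real measure)) borel" by measurable
  show "integrable lborel (\<lambda>x. \<Prod>d\<in>D. h d (d \<bullet> x))"
    unfolding lborel_eq_distr_coordinates[OF D] integrable_distr_eq[OF s m']
    using orthonormal_basis_of_finite[OF D] h
    by (simp add: coordinate_of_sum[OF D] lb.product_integrable_prod cong: prod.cong)
  show "(\<integral>x. (\<Prod>d\<in>D. h d (d \<bullet> x)) \<partial>lborel) = (\<Prod>d\<in>D. \<integral>t. h d t \<partial>lborel)"
    unfolding lborel_eq_distr_coordinates[OF D] integral_distr[OF s m']
    using orthonormal_basis_of_finite[OF D] h
    by (simp add: coordinate_of_sum[OF D] lb.product_integral_prod cong: prod.cong)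
qed

text \<open>Orthonormal bases are sets, so sums over a family of vectors need this reindexing. It serves both
to pass from \<open>H\<close> to coordinates and from coordinates to the isometric copy of \<open>H\<close> in \<open>\<real>\<^sup>N\<close>.\<close>

lemma lborel_onb_indexed:
  fixes \<beta> :: "'i \<Rightarrow> 'a::euclidean_space"
  assumes fin: "finite I" and inj: "inj_on \<beta> I"
  shows "lborel_onb (\<beta> ` I) = distr (\<Pi>\<^sub>M i\<in>I. (lborel :: real measure)) borel (\<lambda>f. \<Sum>i\<in>I. f i *\<^sub>R \<beta> i)"
proof -
  let ?B = "\<beta> ` I"
  let ?PI = "\<Pi>\<^sub>M i\<in>I. (lborel :: real measure)"
  let ?PB = "\<Pi>\<^sub>M i\<in>?B. (lborel :: real measure)"
  let ?r = "\<lambda>f. \<lambda>b\<in>?B. f (the_inv_into I \<beta> b)"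
  have inv: "the_inv_into I \<beta> (\<beta> i) = i" if "i \<in> I" for i
    using inj that by (rule the_inv_into_f_f)
  have rm[measurable]: "?r \<in> measurable ?PI ?PB"
    using inv by (intro measurable_restrict measurable_component_singleton) auto
  have "distr ?PI ?PB ?r = ?PB"
  proof (rule lb.PiM_eqI)
    fix A :: "'a \<Rightarrow> real set" assume A: "\<And>i. i \<in> ?B \<Longrightarrow> A i \<in> sets lborel"
    have "?r -` Pi\<^sub>E ?B A \<inter> space ?PI = Pi\<^sub>E I (\<lambda>i. A (\<beta> i))"
      using inv by (auto simp: space_PiM PiE_iff)
    moreover have "Pi\<^sub>E ?B A \<in> sets ?PB"
      using A fin by (intro sets_PiM_I_finite) auto
    ultimately have "emeasure (distr ?PI ?PB ?r) (Pi\<^sub>E ?B A) = emeasure ?PI (Pi\<^sub>E I (\<lambda>i. A (\<beta> i)))"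
      by (simp add: emeasure_distr)
    also have "\<dots> = (\<Prod>i\<in>I. emeasure lborel (A (\<beta> i)))"
      using A fin by (intro lb.emeasure_PiM) auto
    also have "\<dots> = (\<Prod>b\<in>?B. emeasure lborel (A b))"
      using inj by (simp add: prod.reindex)
    finally show "emeasure (distr ?PI ?PB ?r) (Pi\<^sub>E ?B A) = (\<Prod>b\<in>?B. emeasure lborel (A b))" .
  qed (use fin in auto)
  then have "lborel_onb ?B = distr (distr ?PI ?PB ?r) borel (\<lambda>f. \<Sum>b\<in>?B. f b *\<^sub>R b)"
    by (simp add: lborel_onb_def)
  also have "\<dots> = distr ?PI borel ((\<lambda>f. \<Sum>b\<in>?B. f b *\<^sub>R b) \<circ> ?r)"
    by (rule distr_distr) measurable
  also have "\<dots> = distr ?PI borel (\<lambda>f. \<Sum>i\<in>I. f i *\<^sub>R \<beta> i)"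
  proof (rule distr_cong)
    fix f
    show "((\<lambda>f. \<Sum>b\<in>?B. f b *\<^sub>R b) \<circ> ?r) f = (\<Sum>i\<in>I. f i *\<^sub>R \<beta> i)"
      using inv by (simp add: sum.reindex[OF inj])
  qed auto
  finally show ?thesis .
qed

text \<open>For orthonormal \<open>C\<close> this is the orthogonal projection to \<open>span C\<close>.\<close>

definition proj_span :: "'a::euclidean_space set \<Rightarrow> 'a \<Rightarrow> 'a" where
  "proj_span C x = (\<Sum>d\<in>C. (d \<bullet> x) *\<^sub>R d)"

lemma inner_proj_span_commute: "x \<bullet> proj_span C y = proj_span C x \<bullet> y"
  by (simp add: proj_span_def inner_sum_left inner_sum_right inner_commute mult.commute)

lemma inner_proj_span: "x \<bullet> proj_span C y = (\<Sum>d\<in>C. (d \<bullet> x) * (d \<bullet> y))"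
  by (simp add: proj_span_def inner_sum_right inner_commute mult.commute)

lemma proj_span_orthonormal:
  assumes "finite C" "pairwise orthogonal C" "\<forall>b\<in>C. norm b = 1"
  shows "proj_span C x \<bullet> proj_span C y = x \<bullet> proj_span C y"
proof -
  have "proj_span C x \<bullet> proj_span C y = (\<Sum>d\<in>C. (d \<bullet> x) * (d \<bullet> proj_span C y))"
    by (subst (1) proj_span_def) (simp add: inner_sum_left)
  also have "\<dots> = (\<Sum>d\<in>C. (d \<bullet> x) * (d \<bullet> y))"
    unfolding proj_span_def using assms by (intro sum.cong) (auto simp: inner_sum_orthonormal)
  finally show ?thesis by (simp add: inner_proj_span)
qed

lemma norm_proj_span_sq:
  assumes "finite C" "pairwise orthogonal C" "\<forall>b\<in>C. norm b = 1"
  shows "(norm (proj_span C x))\<^sup>2 = (\<Sum>d\<in>C. (d \<bullet> x)\<^sup>2)"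
proof -
  have "(norm (proj_span C x))\<^sup>2 = x \<bullet> proj_span C x"
    by (simp only: power2_norm_eq_inner proj_span_orthonormal[OF assms])
  also have "\<dots> = (\<Sum>d\<in>C. (d \<bullet> x)\<^sup>2)" by (simp only: inner_proj_span power2_eq_square)
  finally show ?thesis .
qed

text \<open>Fubini for the splitting of the space into \<open>span B\<close> and \<open>span C\<close>. With weights of mass 1 that are concentrated
near 0, it expresses a volume in \<open>span B\<close> by an integral over a thin neighbourhood of \<open>span B\<close>.\<close>

lemma emeasure_lborel_onb_mult_slab:
  fixes B C :: "'a::euclidean_space set"
  assumes D: "orthonormal_basis_of UNIV (B \<union> C)" and dis: "B \<inter> C = {}"
    and A: "A \<in> sets borel" and h: "\<And>d. d \<in> C \<Longrightarrow> h d \<in> borel_measurable borel"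
  shows "(\<integral>\<^sup>+x. indicator A (proj_span B x) * (\<Prod>d\<in>C. h d (d \<bullet> x)) \<partial>lborel)
    = emeasure (lborel_onb B) A * (\<Prod>d\<in>C. \<integral>\<^sup>+t. h d t \<partial>lborel)"
proof -
  have fin: "finite B" "finite C" using orthonormal_basis_of_finite[OF D] by auto
  let ?P = "\<lambda>I. \<Pi>\<^sub>M b\<in>I. (lborel :: real measure)"
  let ?s = "\<lambda>I f. \<Sum>b\<in>I. f b *\<^sub>R b :: 'a"
  have sm[measurable]: "?s I \<in> measurable (?P I) borel" for I by measurable
  have pm[measurable]: "proj_span B \<in> borel_measurable borel"
    unfolding proj_span_def[abs_def] by measurable
  have hm[measurable]: "(\<lambda>x. h d (d \<bullet> x)) \<in> borel_measurable borel" if "d \<in> C" for d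
    by (rule measurable_compose[OF _ h[OF that]]) measurable
  have indm: "(\<lambda>x. indicator A (proj_span B x) :: ennreal) \<in> borel_measurable borel"
    using A by (intro measurable_compose[OF pm] borel_measurable_indicator)
  let ?F = "\<lambda>x. indicator A (proj_span B x) * (\<Prod>d\<in>C. h d (d \<bullet> x))"
  have Fm: "?F \<in> borel_measurable borel"
    using indm hm by (intro borel_measurable_times_ennreal borel_measurable_prod_ennreal) auto
  let ?G = "\<lambda>f. indicator A (?s B f) * (\<Prod>d\<in>C. h d (f d)) :: ennreal"
  have FG: "?F (?s (B \<union> C) f) = ?G f" for f
  proof -
    have "proj_span B (?s (B \<union> C) f) = ?s B f"
      unfolding proj_span_def by (intro sum.cong refl) (simp add: coordinate_of_sum[OF D])
    then show ?thesis by (simp add: coordinate_of_sum[OF D] cong: prod.cong)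
  qed
  have Gm: "?G \<in> borel_measurable (?P (B \<union> C))"
    using measurable_compose[OF sm[of "B \<union> C"] Fm] unfolding FG .
  have im: "(\<lambda>f. indicator A (?s B f) :: ennreal) \<in> borel_measurable (?P B)"
    using A by (intro measurable_compose[OF sm] borel_measurable_indicator)
  have "(\<integral>\<^sup>+x. ?F x \<partial>lborel) = (\<integral>\<^sup>+f. ?G f \<partial>?P (B \<union> C))"
    unfolding lborel_eq_distr_coordinates[OF D] using Fm by (simp add: nn_integral_distr FG)
  also have "\<dots> = (\<integral>\<^sup>+f. (\<integral>\<^sup>+g. ?G (merge B C (f, g)) \<partial>?P C) \<partial>?P B)"
    by (rule lb.product_nn_integral_fold[OF dis fin Gm])
  also have "\<dots> = (\<integral>\<^sup>+f. (\<integral>\<^sup>+g. indicator A (?s B f) * (\<Prod>d\<in>C. h d (g d)) \<partial>?P C) \<partial>?P B)"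
  proof -
    have "?G (merge B C (f, g)) = indicator A (?s B f) * (\<Prod>d\<in>C. h d (g d))" for f g
      using dis by (intro arg_cong2[where f="(*)"] arg_cong[where f="indicator A"] sum.cong prod.cong)
        (auto simp: merge_def)
    then show ?thesis by simp
  qed
  also have "\<dots> = (\<integral>\<^sup>+f. indicator A (?s B f) * (\<Prod>d\<in>C. \<integral>\<^sup>+t. h d t \<partial>lborel) \<partial>?P B)"
    using fin h by (subst nn_integral_cmult) (auto simp: lb.product_nn_integral_prod)
  also have "\<dots> = (\<integral>\<^sup>+f. indicator A (?s B f) \<partial>?P B) * (\<Prod>d\<in>C. \<integral>\<^sup>+t. h d t \<partial>lborel)"
    by (rule nn_integral_multc[OF im])
  also have "(\<integral>\<^sup>+f. indicator A (?s B f) \<partial>?P B) = emeasure (lborel_onb B) A"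
  proof -
    have "(\<integral>\<^sup>+x. indicator A x \<partial>lborel_onb B) = (\<integral>\<^sup>+f. indicator A (?s B f) \<partial>?P B)"
      unfolding lborel_onb_def using A by (intro nn_integral_distr) auto
    then show ?thesis using A by (simp add: lborel_onb_def)
  qed
  finally show ?thesis .
qed

section \<open>Eigenbases and Ball's determinant inequality\<close>

text \<open>A maximiser of the Rayleigh quotient on the unit sphere of an invariant subspace is an eigenvector.\<close>

lemma self_adjoint_eigenvector:
  fixes A :: "'a::euclidean_space \<Rightarrow> 'a"
  assumes lin: "linear A" and sym: "\<And>x y. A x \<bullet> y = x \<bullet> A y"
    and S: "subspace S" "A ` S \<subseteq> S" "dim S \<noteq> 0"
  shows "\<exists>q\<in>S. norm q = 1 \<and> (\<exists>\<mu>. A q = \<mu> *\<^sub>R q)"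
proof -
  have comp: "compact (sphere 0 1 \<inter> S)"
    using S(1) by (simp add: compact_Int_closed closed_subspace)
  obtain z where "z \<in> S" "z \<noteq> 0" using S dim_eq_0[of S] by auto
  then have "z /\<^sub>R norm z \<in> sphere 0 1 \<inter> S"
    using S(1) by (simp add: subspace_scale)
  then have ne: "sphere 0 1 \<inter> S \<noteq> {}" by blast
  have cont: "continuous_on (sphere 0 1 \<inter> S) (\<lambda>x. x \<bullet> A x)"
    using lin by (intro continuous_intros linear_continuous_on) (simp add: linear_conv_bounded_linear)
  obtain q where q: "q \<in> S" "norm q = 1"
    and max: "\<And>y. y \<in> S \<Longrightarrow> norm y = 1 \<Longrightarrow> y \<bullet> A y \<le> q \<bullet> A q"
    using continuous_attains_sup[OF comp ne cont] by auto
  define \<mu> where "\<mu> = q \<bullet> A q"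
  have le: "y \<bullet> A y \<le> \<mu> * (y \<bullet> y)" if "y \<in> S" for y
  proof (cases "y = 0")
    case False
    have "(y /\<^sub>R norm y) \<bullet> A (y /\<^sub>R norm y) \<le> \<mu>"
      unfolding \<mu>_def using False that S(1) by (intro max) (auto simp: subspace_scale)
    then have "(y \<bullet> A y) / (norm y)\<^sup>2 \<le> \<mu>"
      using lin by (simp add: linear_cmul divide_simps power2_eq_square)
    then show ?thesis using False by (simp add: divide_simps power2_norm_eq_inner split: if_splits)
  qed simp
  define h where "h = A q - \<mu> *\<^sub>R q"
  have hS: "h \<in> S" unfolding h_def using S q by (intro subspace_diff subspace_scale) auto
  have qq: "q \<bullet> q = 1" using q by (simp add: norm_eq_1)
  have hq: "h \<bullet> q = 0"
    unfolding h_def inner_diff_left \<mu>_def inner_scaleR_left qq by (simp add: inner_commute)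
  have hAq: "h \<bullet> A q = h \<bullet> h"
  proof -
    have "A q = h + \<mu> *\<^sub>R q" by (simp add: h_def)
    then show ?thesis using hq by (simp add: inner_add_right)
  qed
  define M where "M = h \<bullet> A h - \<mu> * (h \<bullet> h)"
  \<comment> \<open>\<open>q + t h\<close> cannot beat the maximum, so the coefficient \<open>2 (h \<bullet> h)\<close> of \<open>t\<close> has to vanish.\<close>
  have quad: "2 * t * (h \<bullet> h) + t\<^sup>2 * M \<le> 0" for t
  proof -
    have 1: "(q + t *\<^sub>R h) \<bullet> A (q + t *\<^sub>R h) \<le> \<mu> * ((q + t *\<^sub>R h) \<bullet> (q + t *\<^sub>R h))"
      using S(1) q hS by (intro le subspace_add subspace_scale)
    have 2: "(q + t *\<^sub>R h) \<bullet> A (q + t *\<^sub>R h) = \<mu> + 2 * t * (h \<bullet> h) + t\<^sup>2 * (h \<bullet> A h)"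
      using lin sym[of q h] hAq
      by (simp add: linear_add linear_cmul inner_add_left inner_add_right \<mu>_def power2_eq_square inner_commute algebra_simps)
    have 3: "(q + t *\<^sub>R h) \<bullet> (q + t *\<^sub>R h) = 1 + t\<^sup>2 * (h \<bullet> h)"
      using hq qq by (simp add: inner_add_left inner_add_right power2_eq_square inner_commute)
    show ?thesis using 1[unfolded 2 3] by (simp add: M_def algebra_simps)
  qed
  have "h \<bullet> h = 0"
  proof (rule ccontr)
    assume "h \<bullet> h \<noteq> 0"
    then have pos: "h \<bullet> h > 0" using inner_ge_zero[of h] by linarith
    \<comment> \<open>a step so small that the quadratic term cannot compensate the linear one\<close>
    define t where "t = (h \<bullet> h) / (\<bar>M\<bar> + 1)"
    have t: "t > 0" using pos by (simp add: t_def)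
    have "t * \<bar>M\<bar> \<le> h \<bullet> h" using pos by (simp add: t_def divide_simps)
    moreover have "t * (- M) \<le> t * \<bar>M\<bar>" using t by (intro mult_left_mono) auto
    ultimately have "t * M \<ge> - (h \<bullet> h)" by simp
    then have "2 * (h \<bullet> h) + t * M > 0" using pos by linarith
    then have "t * (2 * (h \<bullet> h) + t * M) > 0" using t by (rule mult_pos_pos[rotated])
    with quad[of t] show False by (simp add: algebra_simps power2_eq_square)
  qed
  then have "A q = \<mu> *\<^sub>R q" by (simp add: h_def)
  with q show ?thesis by blast
qed

text \<open>The spectral theorem, by splitting off one eigenvector at a time; the orthogonal complement of an
eigenvector is again invariant.\<close>

lemma self_adjoint_orthonormal_eigenbasis:
  fixes A :: "'a::euclidean_space \<Rightarrow> 'a"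
  assumes lin: "linear A" and sym: "\<And>x y. A x \<bullet> y = x \<bullet> A y"
    and S: "subspace S" "A ` S \<subseteq> S"
  shows "\<exists>B. orthonormal_basis_of S B \<and> (\<forall>b\<in>B. \<exists>\<mu>. A b = \<mu> *\<^sub>R b)"
  using S
proof (induction "dim S" arbitrary: S)
  case 0
  then have "S = {0}" using dim_eq_0[of S] subspace_0[of S] by auto
  then show ?case by (intro exI[of _ "{}"]) (auto simp: orthonormal_basis_of_def)
next
  case (Suc n)
  obtain q \<mu> where q: "q \<in> S" "norm q = 1" "A q = \<mu> *\<^sub>R q"
    using self_adjoint_eigenvector[OF lin sym Suc.prems] Suc.hyps(2) by (metis Zero_not_Suc)
  define S' where "S' = S \<inter> {x. q \<bullet> x = 0}"
  have sub: "subspace S'" unfolding S'_def by (intro subspace_inter Suc.prems subspace_hyperplane)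
  have inv: "A ` S' \<subseteq> S'"
  proof clarify
    fix x assume x: "x \<in> S'"
    have "q \<bullet> A x = A q \<bullet> x" by (simp add: sym)
    then show "A x \<in> S'" using x Suc.prems q(3) by (auto simp: S'_def)
  qed
  have spanS: "S = span (insert q S')"
  proof
    show "S \<subseteq> span (insert q S')"
    proof
      fix x assume "x \<in> S"
      then have "x - (q \<bullet> x) *\<^sub>R q \<in> S'"
        using q Suc.prems(1) by (auto simp: S'_def subspace_diff subspace_scale inner_diff_right norm_eq_1)
      then have "x - (q \<bullet> x) *\<^sub>R q + (q \<bullet> x) *\<^sub>R q \<in> span (insert q S')"
        by (intro span_add span_scale) (auto intro: span_base)
      then show "x \<in> span (insert q S')" by simp
    qed
    show "span (insert q S') \<subseteq> S"
      using q Suc.prems(1) by (intro span_minimal) (auto simp: S'_def)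
  qed
  have "q \<notin> S'" using q by (auto simp: S'_def norm_eq_1)
  then have "q \<notin> span S'" using sub by (metis span_eq_iff)
  then have "dim S = Suc (dim S')" using spanS by (metis dim_span dim_insert Suc_eq_plus1)
  then obtain B where B: "orthonormal_basis_of S' B" "\<forall>b\<in>B. \<exists>\<mu>. A b = \<mu> *\<^sub>R b"
    using Suc.hyps(1)[OF _ sub inv] Suc.hyps(2) by auto
  have "orthonormal_basis_of S (insert q B)"
    unfolding orthonormal_basis_of_def
  proof (intro conjI)
    show "insert q B \<subseteq> S" using B q by (auto simp: orthonormal_basis_of_def S'_def)
    show "pairwise orthogonal (insert q B)"
      using B by (auto simp: orthonormal_basis_of_def S'_def pairwise_insert orthogonal_def inner_commute)
    show "\<forall>b\<in>insert q B. norm b = 1" using B q by (auto simp: orthonormal_basis_of_def)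
    have "span (insert q B) = span (insert q S')"
    proof -
      have "span B = span S'" using B sub by (metis orthonormal_basis_of_def span_eq_iff)
      then show ?thesis by (simp only: span_insert)
    qed
    then show "span (insert q B) = S" using spanS by simp
  qed
  moreover have "\<forall>b\<in>insert q B. \<exists>\<mu>. A b = \<mu> *\<^sub>R b" using B(2) q(3) by auto
  ultimately show ?case by (intro exI[of _ "insert q B"] conjI)
qed

lemma det_eq_prod_Rayleigh_on_eigenbasis:
  fixes A :: "real^'n \<Rightarrow> real^'n"
  assumes lin: "linear A" and B: "orthonormal_basis_of UNIV B"
    and eig: "\<forall>b\<in>B. \<exists>\<mu>. A b = \<mu> *\<^sub>R b"
  shows "det (matrix A) = (\<Prod>b\<in>B. b \<bullet> A b)"
proof -
  have "card B = CARD('n)" "finite B"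
    using orthonormal_basis_of_finite[OF B] by auto
  then obtain \<beta> where \<beta>: "bij_betw \<beta> (UNIV :: 'n set) B"
    using finite_same_card_bij[of "UNIV :: 'n set" B] by auto
  have \<beta>B: "\<beta> i \<in> B" for i using \<beta> by (auto simp: bij_betw_def)
  have on: "\<beta> i \<bullet> \<beta> j = (if i = j then 1 else 0)" for i j
    using B \<beta>B[of i] \<beta>B[of j] \<beta> unfolding orthonormal_basis_of_def
    by (auto simp: pairwise_def orthogonal_def norm_eq_1 bij_betw_def inj_on_def)
  have Ab: "A (\<beta> i) = (\<beta> i \<bullet> A (\<beta> i)) *\<^sub>R \<beta> i" for i
    using eig \<beta>B[of i] on[of i i] by (metis inner_scaleR_right mult.right_neutral)
  define Q :: "real^'n^'n" where "Q = (\<chi> i j. \<beta> j $ i)"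
  define D :: "real^'n^'n" where "D = (\<chi> i j. if i = j then \<beta> i \<bullet> A (\<beta> i) else 0)"
  have "transpose Q ** Q = mat 1"
    using on by (simp add: vec_eq_iff matrix_matrix_mult_def transpose_def Q_def mat_def inner_vec_def)
  then have dQ: "det Q \<noteq> 0"
    by (metis det_I det_mul mult_zero_right zero_neq_one)
  have "matrix A ** Q = Q ** D"
  proof -
    have "(matrix A ** Q) $ i $ j = (Q ** D) $ i $ j" for i j
    proof -
      have "(matrix A ** Q) $ i $ j = (matrix A *v \<beta> j) $ i"
        by (simp add: matrix_matrix_mult_def matrix_vector_mult_def Q_def)
      also have "\<dots> = A (\<beta> j) $ i" using lin by (simp add: matrix_works)
      also have "\<dots> = (\<beta> j \<bullet> A (\<beta> j)) * \<beta> j $ i" by (subst Ab) simp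
      also have "\<dots> = (Q ** D) $ i $ j"
        by (simp add: matrix_matrix_mult_def Q_def D_def if_distrib[of "\<lambda>x. _ * x"] cong: if_cong)
      finally show ?thesis .
    qed
    then show ?thesis by (simp add: vec_eq_iff)
  qed
  then have "det (matrix A) * det Q = det Q * det D" by (metis det_mul)
  then have "det (matrix A) = det D" using dQ by simp
  also have "\<dots> = (\<Prod>i\<in>UNIV. \<beta> i \<bullet> A (\<beta> i))"
    by (subst det_diagonal) (auto simp: D_def)
  also have "\<dots> = (\<Prod>b\<in>B. b \<bullet> A b)"
    by (rule prod.reindex_bij_betw[OF \<beta>])
  finally show ?thesis .
qed

lemma weighted_AM_GM:
  fixes p l :: "'s \<Rightarrow> real"
  assumes "\<And>j. j \<in> S \<Longrightarrow> 0 \<le> p j" "sum p S = 1" "\<And>j. j \<in> S \<Longrightarrow> 0 < l j"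
  shows "(\<Prod>j\<in>S. l j powr p j) \<le> (\<Sum>j\<in>S. p j * l j)"
proof -
  have fin: "finite S" using assms(2) by (metis sum.infinite zero_neq_one)
  define L where "L = (\<Sum>j\<in>S. p j * ln (l j))"
  have "exp L = exp L * (\<Sum>j\<in>S. p j * (1 + ln (l j) - L))"
    using assms(2) by (simp add: algebra_simps sum.distrib sum_subtractf L_def flip: sum_distrib_left sum_distrib_right)
  also have "\<dots> = (\<Sum>j\<in>S. p j * (exp L * (1 + ln (l j) - L)))"
    by (simp add: sum_distrib_left algebra_simps)
  also have "\<dots> \<le> (\<Sum>j\<in>S. p j * l j)"
  proof (intro sum_mono mult_left_mono)
    fix j assume j: "j \<in> S"
    \<comment> \<open>The tangent line of \<open>exp\<close> at \<open>L\<close>; averaging it over \<open>p\<close> gives \<open>exp L\<close> because \<open>L\<close> is the mean of \<open>ln (l j)\<close>.\<close>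
    have "exp L * (1 + (ln (l j) - L)) \<le> exp L * exp (ln (l j) - L)"
      by (intro mult_left_mono exp_ge_add_one_self) auto
    also have "\<dots> = l j" using assms(3)[OF j] by (simp flip: exp_add)
    finally show "exp L * (1 + ln (l j) - L) \<le> l j" by (simp add: algebra_simps)
  qed (use assms in auto)
  also have "exp L = (\<Prod>j\<in>S. l j powr p j)"
    unfolding L_def exp_sum[OF fin] using assms(3)
    by (intro prod.cong refl) (simp add: powr_def order.strict_implies_not_eq[symmetric])
  finally show ?thesis .
qed

text \<open>For a unit eigenvector \<open>b\<close> the numbers \<open>d j * (u j \<bullet> b)\<^sup>2\<close> are a probability distribution, and the eigenvalue
is the corresponding mean of the \<open>l j\<close>. It is bounded below by the geometric mean; in the product of
these geometric means over an eigenbasis the exponents of \<open>l j\<close> add up to \<open>d j\<close>.\<close>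

lemma Ball_det_inequality:
  fixes u :: "'s \<Rightarrow> real^'n" and d l :: "'s \<Rightarrow> real"
  assumes S: "finite S" and unit: "\<And>j. j \<in> S \<Longrightarrow> norm (u j) = 1"
    and d: "\<And>j. j \<in> S \<Longrightarrow> 0 < d j" and l: "\<And>j. j \<in> S \<Longrightarrow> 0 < l j"
    and frame: "\<And>x. (\<Sum>j\<in>S. d j * (u j \<bullet> x)\<^sup>2) = x \<bullet> x"
  shows "(\<Prod>j\<in>S. l j powr d j) \<le> det (matrix (\<lambda>h. \<Sum>j\<in>S. (d j * l j * (u j \<bullet> h)) *\<^sub>R u j))"
proof -
  let ?A = "\<lambda>h. \<Sum>j\<in>S. (d j * l j * (u j \<bullet> h)) *\<^sub>R u j"
  have lin: "linear ?A"
    by (intro linearI) (auto simp: inner_add_right algebra_simps scaleR_add_left sum.distrib scaleR_sum_right)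
  have sym: "?A x \<bullet> y = x \<bullet> ?A y" for x y
    by (simp add: inner_sum_left inner_sum_right algebra_simps inner_commute)
  obtain B where B: "orthonormal_basis_of UNIV B" "\<forall>b\<in>B. \<exists>\<mu>. ?A b = \<mu> *\<^sub>R b"
    using self_adjoint_orthonormal_eigenbasis[OF lin sym, of UNIV] by auto
  have nB: "norm b = 1" if "b \<in> B" for b using B that by (auto simp: orthonormal_basis_of_def)
  have parseval: "(\<Sum>b\<in>B. (u j \<bullet> b)\<^sup>2) = 1" if "j \<in> S" for j
    using orthonormal_basis_Parseval[OF B(1), of "u j"] unit[OF that] by (simp add: inner_commute norm_eq_1)
  have "(\<Prod>j\<in>S. l j powr d j) = (\<Prod>j\<in>S. \<Prod>b\<in>B. l j powr (d j * (u j \<bullet> b)\<^sup>2))"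
  proof (intro prod.cong refl)
    fix j assume j: "j \<in> S"
    have "(\<Prod>b\<in>B. l j powr (d j * (u j \<bullet> b)\<^sup>2)) = l j powr (\<Sum>b\<in>B. d j * (u j \<bullet> b)\<^sup>2)"
      using l[OF j] orthonormal_basis_of_finite[OF B(1)] by (simp add: powr_sum)
    then show "l j powr d j = (\<Prod>b\<in>B. l j powr (d j * (u j \<bullet> b)\<^sup>2))"
      using parseval[OF j] by (simp flip: sum_distrib_left)
  qed
  also have "\<dots> = (\<Prod>b\<in>B. \<Prod>j\<in>S. l j powr (d j * (u j \<bullet> b)\<^sup>2))" by (rule prod.swap)
  also have "\<dots> \<le> (\<Prod>b\<in>B. b \<bullet> ?A b)"
  proof (intro prod_mono conjI prod_nonneg powr_ge_zero ballI)
    fix b assume b: "b \<in> B"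
    have "(\<Prod>j\<in>S. l j powr (d j * (u j \<bullet> b)\<^sup>2)) \<le> (\<Sum>j\<in>S. (d j * (u j \<bullet> b)\<^sup>2) * l j)"
      using d l frame[of b] nB[OF b] by (intro weighted_AM_GM) (auto simp: norm_eq_1 less_imp_le)
    also have "\<dots> = b \<bullet> ?A b"
      by (simp add: inner_sum_right power2_eq_square algebra_simps inner_commute)
    finally show "(\<Prod>j\<in>S. l j powr (d j * (u j \<bullet> b)\<^sup>2)) \<le> b \<bullet> ?A b" .
  qed
  also have "\<dots> = det (matrix ?A)"
    using det_eq_prod_Rayleigh_on_eigenbasis[OF lin B] by simp
  finally show ?thesis .
qed

section \<open>Monotone transport to the Gaussian\<close>

lemma strict_mono_if_deriv_pos:
  fixes f :: "real \<Rightarrow> real"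
  assumes "\<And>x. (f has_real_derivative f' x) (at x)" "\<And>x. 0 < f' x"
  shows "strict_mono f"
proof (rule strict_monoI)
  fix x y :: real assume "x < y"
  then show "f x < f y"
  proof (rule DERIV_pos_imp_increasing)
    fix z show "\<exists>D. (f has_real_derivative D) (at z) \<and> 0 < D"
      by (rule exI[of _ "f' z"]) (simp add: assms)
  qed
qed

lemma distribution_function_of_density:
  fixes f :: "real \<Rightarrow> real"
  assumes cont: "continuous_on UNIV f" and pos: "\<And>x. 0 < f x"
    and int: "integrable lborel f" and one: "(\<integral>x. f x \<partial>lborel) = 1"
  obtains F where "\<And>x. (F has_real_derivative f x) (at x)" "strict_mono F"
    "(F \<longlongrightarrow> 0) at_bot" "(F \<longlongrightarrow> 1) at_top" "\<And>x. 0 < F x" "\<And>x. F x < 1"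
proof -
  define M where "M = density lborel (\<lambda>x. ennreal (f x))"
  have [measurable]: "f \<in> borel_measurable borel" using cont by (rule borel_measurable_continuous_onI)
  have "prob_space M"
    unfolding M_def using int one pos
    by (intro prob_spaceI) (simp add: emeasure_density nn_integral_eq_integral less_imp_le)
  then interpret M: real_distribution M
    by (simp add: real_distribution_def real_distribution_axioms_def M_def)
  define F where "F = cdf M"
  have der: "(F has_real_derivative f x) (at x)" for x
  proof -
    \<comment> \<open>The fundamental theorem of calculus applies to integrals over compact intervals, hence the base point.\<close>
    have eq: "F y = F (x - 1) + integral {x - 1..y} f" if "y \<in> {x - 1..x + 1}" for y
    proof (cases "y = x - 1")
      case False
      then have lt: "x - 1 < y" using that by simp
      have "F y - F (x - 1) = measure M {x - 1<..y}"
        unfolding F_def by (rule M.cdf_diff_eq[OF lt])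
      also have "\<dots> = (\<integral>t. indicator {x - 1<..y} t * f t \<partial>lborel)"
      proof -
        have "emeasure M {x - 1<..y} = (\<integral>\<^sup>+t. ennreal (indicator {x - 1<..y} t * f t) \<partial>lborel)"
          unfolding M_def by (subst emeasure_density) (auto intro!: nn_integral_cong simp: indicator_def)
        also have "\<dots> = ennreal (\<integral>t. indicator {x - 1<..y} t * f t \<partial>lborel)"
          using integrable_mult_indicator[of "{x - 1<..y}" lborel f] int pos
          by (intro nn_integral_eq_integral) (auto simp: less_imp_le)
        moreover have "0 \<le> (\<integral>t. indicator {x - 1<..y} t * f t \<partial>lborel)"
          using pos by (intro integral_nonneg_AE AE_I2) (simp add: less_imp_le)
        ultimately show ?thesis by (simp add: measure_def)
      qed
      also have "\<dots> = (LBINT t:{x - 1..y}. f t)"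
        unfolding set_lebesgue_integral_def
        by (intro integral_cong_AE AE_I[of _ _ "{x - 1}"]) (auto simp: indicator_def)
      also have "\<dots> = integral {x - 1..y} f"
      proof (rule set_borel_integral_eq_integral)
        show "set_integrable lborel {x - 1..y} f"
          unfolding set_integrable_def using int by (intro integrable_mult_indicator) auto
      qed
      finally show ?thesis by simp
    qed simp
    have "((\<lambda>y. F (x - 1) + integral {x - 1..y} f) has_real_derivative f x) (at x within {x - 1..x + 1})"
    proof -
      have "((\<lambda>y. integral {x - 1..y} f) has_real_derivative f x) (at x within {x - 1..x + 1})"
        using continuous_on_subset[OF cont] by (intro integral_has_real_derivative) auto
      from DERIV_add[OF DERIV_const this] show ?thesis by simp
    qed
    then have "(F has_real_derivative f x) (at x within {x - 1..x + 1})"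
    proof (rule has_field_derivative_transform_within[of _ _ _ _ 1])
      fix y assume "y \<in> {x - 1..x + 1}"
      then show "F (x - 1) + integral {x - 1..y} f = F y" by (rule eq[symmetric])
    qed auto
    moreover have "at x within {x - 1..x + 1} = at x" by (rule at_within_Icc_at) auto
    ultimately show ?thesis by simp
  qed
  have sm: "strict_mono F"
    using der pos by (rule strict_mono_if_deriv_pos)
  have bot: "(F \<longlongrightarrow> 0) at_bot" unfolding F_def by (rule M.cdf_lim_at_bot)
  have top: "(F \<longlongrightarrow> 1) at_top" unfolding F_def by (rule M.cdf_lim_at_top_prob)
  have "0 < F x" for x
  proof -
    have "0 \<le> F (x - 1)" unfolding F_def by (rule M.cdf_nonneg)
    also have "F (x - 1) < F x" using sm by (simp add: strict_mono_def)
    finally show ?thesis .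
  qed
  moreover have "F x < 1" for x
  proof -
    have "F x < F (x + 1)" using sm by (simp add: strict_mono_def)
    also have "F (x + 1) \<le> 1" unfolding F_def by (rule M.cdf_bounded_prob)
    finally show ?thesis .
  qed
  ultimately show ?thesis using that der sm bot top by blast
qed

text \<open>\<open>T\<close> is the inverse of the normal distribution function composed with the normalised distribution
function of \<open>f\<close>. The equation is the change of variables formula for densities.\<close>

lemma transport_to_std_normal:
  fixes f :: "real \<Rightarrow> real"
  assumes cont: "continuous_on UNIV f" and pos: "\<And>x. 0 < f x" and int: "integrable lborel f"
  obtains T T' where "\<And>x. (T has_real_derivative T' x) (at x)" "\<And>x. 0 < T' x"
    "\<And>x. f x = (\<integral>x. f x \<partial>lborel) * (std_normal_density (T x) * T' x)"
proof -
  define C where "C = (\<integral>x. f x \<partial>lborel)"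
  have "C \<ge> 0" unfolding C_def using pos by (intro integral_nonneg_AE) (simp add: less_imp_le)
  moreover have "C \<noteq> 0"
  proof
    assume "C = 0"
    then have "AE x in lborel. f x = 0"
      unfolding C_def using int pos by (subst (asm) integral_nonneg_eq_0_iff_AE) (auto simp: less_imp_le)
    moreover have "f x \<noteq> 0" for x using pos[of x] by simp
    ultimately show False by (simp add: eventually_False ae_filter_eq_bot_iff)
  qed
  ultimately have C: "C > 0" by simp
  obtain F where F: "\<And>x. (F has_real_derivative f x / C) (at x)" "strict_mono F"
    "(F \<longlongrightarrow> 0) at_bot" "(F \<longlongrightarrow> 1) at_top" "\<And>x. 0 < F x" "\<And>x. F x < 1"
  proof (rule distribution_function_of_density[of "\<lambda>x. f x / C"])
    show "continuous_on UNIV (\<lambda>x. f x / C)" using cont C by (intro continuous_intros) auto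
  qed (use int C pos in \<open>auto simp: C_def[symmetric]\<close>)
  obtain G where G: "\<And>x. (G has_real_derivative std_normal_density x) (at x)" "strict_mono G"
    "(G \<longlongrightarrow> 0) at_bot" "(G \<longlongrightarrow> 1) at_top" "\<And>x. 0 < G x" "\<And>x. G x < 1"
  proof (rule distribution_function_of_density[of std_normal_density])
    show "continuous_on UNIV std_normal_density"
      unfolding std_normal_density_def by (intro continuous_intros) auto
  qed (auto simp: normal_density_pos)
  have contG: "continuous_on A G" for A
    using G(1) by (intro continuous_at_imp_continuous_on) (auto intro: DERIV_isCont)
  have contF: "continuous_on A F" for A
    using F(1) by (intro continuous_at_imp_continuous_on) (auto intro: DERIV_isCont)
  have ex: "\<exists>t. G t = y" if y: "0 < y" "y < 1" for y
  proof -
    obtain a where a: "G a < y"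
      using order_tendstoD(2)[OF G(3) y(1)] by (metis eventually_happens trivial_limit_at_bot_linorder)
    obtain b where b: "y < G b"
      using order_tendstoD(1)[OF G(4) y(2)] by (metis eventually_happens trivial_limit_at_top_linorder)
    have "a \<le> b" using a b G(2) by (metis less_imp_le less_trans linorder_not_le strict_mono_less)
    then show ?thesis using IVT'[of G a y b] a b contG by auto
  qed
  define T where "T = (\<lambda>x. SOME t. G t = F x)"
  have GT: "G (T x) = F x" for x
    unfolding T_def by (rule someI_ex) (use ex F in auto)
  define I where "I = (\<lambda>y. SOME t. G t = y)"
  have IG: "I (G t) = t" for t
    unfolding I_def using G(2) by (intro some_equality) (auto simp: strict_mono_eq)
  have T: "T x = I (F x)" for x by (simp add: T_def I_def)
  have derI: "(I has_real_derivative inverse (std_normal_density (T x))) (at (F x))" for x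
  proof -
    have "(I has_derivative (*) (inverse (std_normal_density (T x)))) (at (G (T x)))"
    proof (rule has_derivative_inverse_strong[of UNIV "T x" G I "(*) (std_normal_density (T x))"])
      show "(G has_derivative (*) (std_normal_density (T x))) (at (T x))"
        using G(1) by (simp add: has_field_derivative_def)
      show "(*) (std_normal_density (T x)) \<circ> (*) (inverse (std_normal_density (T x))) = id"
        using normal_density_pos[of 1 0 "T x"] by (auto simp: fun_eq_iff)
    qed (use contG IG in auto)
    then show ?thesis by (simp add: has_field_derivative_def GT)
  qed
  define T' where "T' = (\<lambda>x. inverse (std_normal_density (T x)) * (f x / C))"
  have "T = (\<lambda>x. I (F x))" by (simp add: T fun_eq_iff)
  then have "(T has_real_derivative T' x) (at x)" for x
    unfolding T'_def using DERIV_chain2[OF derI F(1), of x] by simp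
  moreover have "0 < T' x" for x
    unfolding T'_def using C pos normal_density_pos[of 1 0 "T x"] by simp
  moreover have "f x = C * (std_normal_density (T x) * T' x)" for x
    unfolding T'_def using C normal_density_pos[of 1 0 "T x"] by simp
  ultimately show ?thesis using that unfolding C_def by blast
qed

section \<open>The geometric Brascamp-Lieb inequality\<close>

lemma has_absolute_integral_change_of_variables_real_valued:
  fixes f :: "real^'m::{finite,wellorder} \<Rightarrow> real" and g :: "real^'m::_ \<Rightarrow> real^'m::_"
  assumes S: "S \<in> sets lebesgue"
    and der_g: "\<And>x. x \<in> S \<Longrightarrow> (g has_derivative g' x) (at x within S)"
    and inj: "inj_on g S"
  shows "(\<lambda>x. \<bar>det (matrix (g' x))\<bar> * f(g x)) absolutely_integrable_on S \<and>
           integral S (\<lambda>x. \<bar>det (matrix (g' x))\<bar> * f (g x)) = b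
     \<longleftrightarrow> f absolutely_integrable_on (g ` S) \<and> integral (g ` S) f = b"
proof -
  have "(\<lambda>x. \<bar>det (matrix (g' x))\<bar> *\<^sub>R vec (f(g x)) :: real ^ 1) absolutely_integrable_on S \<and>
           integral S (\<lambda>x. \<bar>det (matrix (g' x))\<bar> *\<^sub>R vec (f(g x))) = (vec b :: real ^ 1)
         \<longleftrightarrow> (\<lambda>x. vec (f x) :: real ^ 1) absolutely_integrable_on (g ` S) \<and>
           integral (g ` S) (\<lambda>x. vec (f x)) = (vec b :: real ^ 1)"
    using assms by (intro has_absolute_integral_change_of_variables) auto
  then show ?thesis
    by (simp add: absolutely_integrable_on_1_iff integral_on_1_eq)
qed

text \<open>Here, as in \<open>Ball_det_inequality\<close> and below, the decomposition of the identity by vectors \<open>u j\<close> with weights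
\<open>d j\<close> is assumed as an identity of quadratic forms. The operator identity follows by polarisation.\<close>

lemma tight_frame_expansion:
  fixes u :: "'s \<Rightarrow> 'a::euclidean_space"
  assumes frame: "\<And>x. (\<Sum>j\<in>S. d j * (u j \<bullet> x)\<^sup>2) = x \<bullet> x"
  shows "(\<Sum>j\<in>S. (d j * (u j \<bullet> x)) *\<^sub>R u j) = x"
proof -
  let ?A = "\<lambda>x. (\<Sum>j\<in>S. (d j * (u j \<bullet> x)) *\<^sub>R u j)"
  have b: "?A x \<bullet> y = (\<Sum>j\<in>S. d j * (u j \<bullet> x) * (u j \<bullet> y))" for x y
    by (simp add: inner_sum_left)
  have "?A x \<bullet> y = x \<bullet> y" for y
  proof -
    have "4 * (?A x \<bullet> y) = (\<Sum>j\<in>S. d j * (u j \<bullet> (x + y))\<^sup>2) - (\<Sum>j\<in>S. d j * (u j \<bullet> (x - y))\<^sup>2)"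
      unfolding b sum_distrib_left sum_subtractf[symmetric]
      by (intro sum.cong) (auto simp: inner_add_right inner_diff_right power2_eq_square algebra_simps)
    also have "\<dots> = 4 * (x \<bullet> y)"
      unfolding frame by (simp add: inner_add_left inner_add_right inner_diff_left inner_diff_right inner_commute)
    finally show ?thesis by simp
  qed
  then show ?thesis by (metis vector_eq_rdot)
qed

lemma tight_frame_sum_weights:
  fixes u :: "'s \<Rightarrow> 'a::euclidean_space"
  assumes frame: "\<And>x. (\<Sum>j\<in>S. d j * (u j \<bullet> x)\<^sup>2) = x \<bullet> x" and "\<And>j. j \<in> S \<Longrightarrow> norm (u j) = 1"
  shows "(\<Sum>j\<in>S. d j) = DIM('a)"
proof -
  have "real DIM('a) = (\<Sum>b\<in>Basis. (b::'a) \<bullet> b)" by simp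
  also have "\<dots> = (\<Sum>b\<in>Basis. \<Sum>j\<in>S. d j * (u j \<bullet> b)\<^sup>2)" by (simp only: frame)
  also have "\<dots> = (\<Sum>j\<in>S. \<Sum>b\<in>Basis. d j * (u j \<bullet> b)\<^sup>2)" by (rule sum.swap)
  also have "\<dots> = (\<Sum>j\<in>S. d j * (\<Sum>b\<in>Basis. (b \<bullet> u j)\<^sup>2))"
    by (simp add: sum_distrib_left inner_commute)
  also have "\<dots> = (\<Sum>j\<in>S. d j * (u j \<bullet> u j))"
    by (simp only: orthonormal_basis_Parseval[OF orthonormal_basis_of_Basis])
  also have "\<dots> = (\<Sum>j\<in>S. d j)" using assms(2) by (intro sum.cong) (auto simp: norm_eq_1)
  finally show ?thesis by simp
qed

text \<open>This makes the transport map of the Brascamp-Lieb inequality compatible with the Gaussian: the exponent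
at its image is at most the weighted sum of the one-dimensional exponents.\<close>

lemma norm_tight_frame_combination_le:
  fixes u :: "'s \<Rightarrow> 'a::euclidean_space"
  assumes frame: "\<And>x. (\<Sum>j\<in>S. d j * (u j \<bullet> x)\<^sup>2) = x \<bullet> x" and d: "\<And>j. j \<in> S \<Longrightarrow> 0 \<le> d j"
  shows "(norm (\<Sum>j\<in>S. (d j * t j) *\<^sub>R u j))\<^sup>2 \<le> (\<Sum>j\<in>S. d j * (t j)\<^sup>2)"
proof -
  define z where "z = (\<Sum>j\<in>S. (d j * t j) *\<^sub>R u j)"
  \<comment> \<open>\<open>u j \<bullet> z\<close> are the frame coefficients of \<open>z\<close>; they are the \<open>d\<close>-orthogonal projection of \<open>t\<close>.\<close>
  have "0 \<le> (\<Sum>j\<in>S. d j * (t j - u j \<bullet> z)\<^sup>2)"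
    using d by (intro sum_nonneg) auto
  also have "\<dots> = (\<Sum>j\<in>S. d j * (t j)\<^sup>2) - 2 * (\<Sum>j\<in>S. d j * t j * (u j \<bullet> z)) + (\<Sum>j\<in>S. d j * (u j \<bullet> z)\<^sup>2)"
    by (simp add: power2_diff algebra_simps sum.distrib sum_subtractf sum_distrib_left)
  also have "(\<Sum>j\<in>S. d j * t j * (u j \<bullet> z)) = z \<bullet> z"
    by (subst (2) z_def) (simp add: inner_sum_left)
  also have "(\<Sum>j\<in>S. d j * (u j \<bullet> z)\<^sup>2) = z \<bullet> z" by (rule frame)
  finally show ?thesis by (simp add: z_def power2_norm_eq_inner)
qed

text \<open>The inner product of \<open>y - z\<close> with the difference of the images of \<open>y\<close> and \<open>z\<close> is a sum of nonnegative terms,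
and one of them is positive because the \<open>u j\<close> span the space.\<close>

lemma strict_mono_frame_map_inj:
  fixes u :: "'s \<Rightarrow> 'a::euclidean_space"
  assumes S: "finite S" and frame: "\<And>x. (\<Sum>j\<in>S. d j * (u j \<bullet> x)\<^sup>2) = x \<bullet> x"
    and d: "\<And>j. j \<in> S \<Longrightarrow> 0 < d j" and mono: "\<And>j. j \<in> S \<Longrightarrow> strict_mono (T j :: real \<Rightarrow> real)"
  shows "inj (\<lambda>y. \<Sum>j\<in>S. (d j * T j (u j \<bullet> y)) *\<^sub>R u j)"
proof (rule injI, rule ccontr)
  fix y z
  assume eq: "(\<Sum>j\<in>S. (d j * T j (u j \<bullet> y)) *\<^sub>R u j) = (\<Sum>j\<in>S. (d j * T j (u j \<bullet> z)) *\<^sub>R u j)"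
    and "y \<noteq> z"
  let ?g = "\<lambda>j. d j * ((T j (u j \<bullet> y) - T j (u j \<bullet> z)) * (u j \<bullet> y - u j \<bullet> z))"
  have "(\<Sum>j\<in>S. ?g j) = ((\<Sum>j\<in>S. (d j * T j (u j \<bullet> y)) *\<^sub>R u j) - (\<Sum>j\<in>S. (d j * T j (u j \<bullet> z)) *\<^sub>R u j)) \<bullet> (y - z)"
    unfolding sum_subtractf[symmetric] inner_sum_left
    by (intro sum.cong) (auto simp: inner_diff_right inner_diff_left algebra_simps)
  then have "(\<Sum>j\<in>S. ?g j) = 0" using eq by simp
  moreover have pos: "(T j s - T j t) * (s - t) > 0" if "j \<in> S" "s \<noteq> t" for j s t
    using mono[OF that(1)] that(2) by (cases "s < t") (auto simp: strict_mono_def mult_neg_neg)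
  have "0 \<le> ?g j" if "j \<in> S" for j
    using d[OF that] pos[OF that, of "u j \<bullet> y" "u j \<bullet> z"] by (cases "u j \<bullet> y = u j \<bullet> z") auto
  ultimately have zero: "?g j = 0" if "j \<in> S" for j
    using S that by (simp add: sum_nonneg_eq_0_iff)
  have "u j \<bullet> (y - z) = 0" if "j \<in> S" for j
  proof (rule ccontr)
    assume "u j \<bullet> (y - z) \<noteq> 0"
    then have "u j \<bullet> y \<noteq> u j \<bullet> z" by (simp add: inner_diff_right)
    then show False using zero[OF that] d[OF that] pos[OF that, of "u j \<bullet> y" "u j \<bullet> z"] by auto
  qed
  then have "(y - z) \<bullet> (y - z) = 0" by (simp flip: frame)
  then show False using \<open>y \<noteq> z\<close> by simp
qed

text \<open>Equality holds when all \<open>f j\<close> are the same centred Gaussian, which is why Gaussians are the right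
target of the transport.\<close>

theorem geometric_Brascamp_Lieb:
  fixes u :: "'s \<Rightarrow> real^'n::{finite,wellorder}" and f :: "'s \<Rightarrow> real \<Rightarrow> real"
  assumes S: "finite S" and unit: "\<And>j. j \<in> S \<Longrightarrow> norm (u j) = 1"
    and d: "\<And>j. j \<in> S \<Longrightarrow> 0 < d j"
    and frame: "\<And>x. (\<Sum>j\<in>S. d j * (u j \<bullet> x)\<^sup>2) = x \<bullet> x"
    and cont: "\<And>j. j \<in> S \<Longrightarrow> continuous_on UNIV (f j)"
    and pos: "\<And>j x. j \<in> S \<Longrightarrow> 0 < f j x"
    and int: "\<And>j. j \<in> S \<Longrightarrow> integrable lborel (f j)"
  shows "(\<integral>\<^sup>+y. ennreal (\<Prod>j\<in>S. f j (u j \<bullet> y) powr d j) \<partial>lborel)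
           \<le> ennreal (\<Prod>j\<in>S. (\<integral>x. f j x \<partial>lborel) powr d j)"
proof -
  define C where "C j = (\<integral>x. f j x \<partial>lborel)" for j
  have "\<forall>j\<in>S. \<exists>T T'. (\<forall>x. (T has_real_derivative T' x) (at x)) \<and> (\<forall>x. 0 < T' x) \<and>
      (\<forall>x. f j x = C j * (std_normal_density (T x) * T' x))"
    unfolding C_def using transport_to_std_normal[OF cont pos int] by metis
  then obtain T T' where T: "\<And>j x. j \<in> S \<Longrightarrow> (T j has_real_derivative T' j x) (at x)"
    and T'pos: "\<And>j x. j \<in> S \<Longrightarrow> 0 < T' j x"
    and Teq: "\<And>j x. j \<in> S \<Longrightarrow> f j x = C j * (std_normal_density (T j x) * T' j x)"
    by metis
  have Cnonneg: "0 \<le> C j" if "j \<in> S" for j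
    unfolding C_def using pos[OF that] by (intro integral_nonneg_AE) (simp add: less_imp_le)
  define \<Theta> where "\<Theta> y = (\<Sum>j\<in>S. (d j * T j (u j \<bullet> y)) *\<^sub>R u j)" for y
  define \<Theta>' where "\<Theta>' y h = (\<Sum>j\<in>S. (d j * T' j (u j \<bullet> y) * (u j \<bullet> h)) *\<^sub>R u j)" for y h
  define \<gamma> where "\<gamma> z = (\<Prod>b\<in>Basis. std_normal_density (b \<bullet> z))" for z :: "real^'n::_"
  have \<gamma>_eq: "\<gamma> z = (1 / sqrt (2 * pi)) ^ CARD('n) * exp (- (norm z)\<^sup>2 / 2)" for z
  proof -
    have "\<gamma> z = (1 / sqrt (2 * pi)) ^ CARD('n) * exp (- (\<Sum>b\<in>Basis. (b \<bullet> z)\<^sup>2) / 2)"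
      unfolding \<gamma>_def std_normal_density_def prod.distrib prod_constant
      by (simp add: exp_sum sum_negf sum_divide_distrib flip: sum_negf)
    then show ?thesis
      by (simp only: orthonormal_basis_Parseval[OF orthonormal_basis_of_Basis] power2_norm_eq_inner)
  qed
  have \<gamma>_int: "integrable lborel \<gamma>"
    unfolding \<gamma>_def by (intro integrable_coordinate_prod orthonormal_basis_of_Basis) auto
  have \<gamma>_1: "(\<integral>z. \<gamma> z \<partial>lborel) = 1"
    unfolding \<gamma>_def by (subst integral_coordinate_prod) (auto simp: orthonormal_basis_of_Basis)
  have \<gamma>_nonneg: "0 \<le> \<gamma> z" for z by (simp add: \<gamma>_eq)
  have der: "(\<Theta> has_derivative \<Theta>' y) (at y)" for y
  proof -
    have "((\<lambda>y. (d j * T j (u j \<bullet> y)) *\<^sub>R u j) has_derivative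
        (\<lambda>h. (d j * T' j (u j \<bullet> y) * (u j \<bullet> h)) *\<^sub>R u j)) (at y)" if "j \<in> S" for j
    proof -
      have "(T j has_derivative (*) (T' j (u j \<bullet> y))) (at (u j \<bullet> y))"
        using T[OF that] by (simp add: has_field_derivative_def)
      then have "((\<lambda>y. T j (u j \<bullet> y)) has_derivative (\<lambda>h. T' j (u j \<bullet> y) * (u j \<bullet> h))) (at y)"
        by (rule has_derivative_compose[of "\<lambda>y. u j \<bullet> y" "\<lambda>h. u j \<bullet> h" y UNIV "T j", rotated])
          (intro derivative_intros)
      from has_derivative_scaleR_left[OF has_derivative_mult_right[OF this, of "d j"], of "u j"]
      show ?thesis by (simp add: mult.assoc)
    qed
    then show ?thesis
      unfolding \<Theta>_def[abs_def] \<Theta>'_def[abs_def] by (rule has_derivative_sum)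
  qed
  have mono: "strict_mono (T j)" if "j \<in> S" for j
    using T[OF that] T'pos[OF that] by (rule strict_mono_if_deriv_pos)
  have inj: "inj \<Theta>"
    unfolding \<Theta>_def[abs_def] by (rule strict_mono_frame_map_inj[OF S frame d mono])
  have det_ge: "(\<Prod>j\<in>S. T' j (u j \<bullet> y) powr d j) \<le> det (matrix (\<Theta>' y))" for y
    unfolding \<Theta>'_def[abs_def] by (intro Ball_det_inequality S unit d T'pos frame)
  \<comment> \<open>Every \<open>f j\<close> is split by the transport into a Gaussian factor, controlled by \<open>\<gamma> (\<Theta> y)\<close>, and a
    derivative factor, controlled by the Jacobian determinant of \<open>\<Theta>\<close>.\<close>
  have key: "(\<Prod>j\<in>S. f j (u j \<bullet> y) powr d j)
      \<le> (\<Prod>j\<in>S. C j powr d j) * (\<bar>det (matrix (\<Theta>' y))\<bar> * \<gamma> (\<Theta> y))" for y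
  proof -
    let ?t = "\<lambda>j. T j (u j \<bullet> y)"
    have "(\<Prod>j\<in>S. f j (u j \<bullet> y) powr d j)
        = (\<Prod>j\<in>S. C j powr d j * (std_normal_density (?t j) powr d j * T' j (u j \<bullet> y) powr d j))"
      using Cnonneg T'pos by (intro prod.cong refl) (simp add: Teq powr_mult less_imp_le)
    also have "\<dots> = (\<Prod>j\<in>S. C j powr d j) *
        ((\<Prod>j\<in>S. std_normal_density (?t j) powr d j) * (\<Prod>j\<in>S. T' j (u j \<bullet> y) powr d j))"
      by (simp add: prod.distrib)
    also have "(\<Prod>j\<in>S. std_normal_density (?t j) powr d j) =
        (\<Prod>j\<in>S. (1 / sqrt (2 * pi)) powr d j * exp (- (d j * (?t j)\<^sup>2) / 2))"
      unfolding std_normal_density_def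
      by (intro prod.cong refl) (simp add: powr_mult powr_def[of "exp _"] powr_divide algebra_simps)
    also have "\<dots> = (1 / sqrt (2 * pi)) powr (\<Sum>j\<in>S. d j) * exp (- (\<Sum>j\<in>S. d j * (?t j)\<^sup>2) / 2)"
      using S by (simp add: prod.distrib powr_sum exp_sum sum_divide_distrib flip: sum_negf)
    also have "\<dots> = (1 / sqrt (2 * pi)) ^ CARD('n) * exp (- (\<Sum>j\<in>S. d j * (?t j)\<^sup>2) / 2)"
      using tight_frame_sum_weights[OF frame unit] by (simp add: powr_realpow)
    also have "\<dots> \<le> \<gamma> (\<Theta> y)"
      unfolding \<gamma>_eq \<Theta>_def using norm_tight_frame_combination_le[OF frame, of "?t"] d
      by (simp add: less_imp_le)
    finally have "(\<Prod>j\<in>S. f j (u j \<bullet> y) powr d j) \<le>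
        (\<Prod>j\<in>S. C j powr d j) * (\<gamma> (\<Theta> y) * (\<Prod>j\<in>S. T' j (u j \<bullet> y) powr d j))"
      by (simp add: mult_left_mono mult_right_mono prod_nonneg)
    also have "\<dots> \<le> (\<Prod>j\<in>S. C j powr d j) * (\<gamma> (\<Theta> y) * \<bar>det (matrix (\<Theta>' y))\<bar>)"
      using det_ge[of y] \<gamma>_nonneg by (intro mult_left_mono prod_nonneg) auto
    finally show ?thesis by (simp add: mult.commute)
  qed
  have \<gamma>_abs: "\<gamma> absolutely_integrable_on UNIV"
    using \<gamma>_int borel_measurable_integrable[OF \<gamma>_int]
    by (simp add: set_integrable_def integrable_completion)
  have im: "range \<Theta> \<in> sets lebesgue"
    using der by (intro differentiable_image_in_sets_lebesgue)
      (auto simp: differentiable_on_def differentiable_def intro: has_derivative_at_withinI)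
  have \<gamma>_abs_im: "\<gamma> absolutely_integrable_on range \<Theta>"
    by (rule set_integrable_subset[OF \<gamma>_abs im]) simp
  define b where "b = integral (range \<Theta>) \<gamma>"
  \<comment> \<open>\<open>\<Theta>\<close> need not be onto, but only an upper bound is wanted.\<close>
  have "b \<le> integral UNIV \<gamma>"
    unfolding b_def using \<gamma>_abs \<gamma>_abs_im \<gamma>_nonneg
    by (intro integral_subset_le) (auto dest: set_lebesgue_integral_eq_integral(1))
  also have "integral UNIV \<gamma> = 1"
    using set_lebesgue_integral_eq_integral(2)[OF \<gamma>_abs] \<gamma>_1 borel_measurable_integrable[OF \<gamma>_int]
    by (simp add: set_lebesgue_integral_def integral_completion)
  finally have b: "b \<le> 1" .
  have cv: "(\<lambda>y. \<bar>det (matrix (\<Theta>' y))\<bar> * \<gamma> (\<Theta> y)) absolutely_integrable_on UNIV"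
    "integral UNIV (\<lambda>y. \<bar>det (matrix (\<Theta>' y))\<bar> * \<gamma> (\<Theta> y)) = b"
    using has_absolute_integral_change_of_variables_real_valued[of UNIV \<Theta> \<Theta>' \<gamma> b] der inj \<gamma>_abs_im
    by (auto simp: b_def)
  let ?G = "\<lambda>y. \<bar>det (matrix (\<Theta>' y))\<bar> * \<gamma> (\<Theta> y)"
  have G: "integrable lebesgue ?G" "(\<integral>y. ?G y \<partial>lebesgue) = b"
    using cv set_lebesgue_integral_eq_integral(2)[OF cv(1)]
    by (simp_all add: set_integrable_def set_lebesgue_integral_def)
  let ?C = "\<Prod>j\<in>S. C j powr d j"
  have "(\<integral>\<^sup>+y. ennreal (\<Prod>j\<in>S. f j (u j \<bullet> y) powr d j) \<partial>lborel)
      = (\<integral>\<^sup>+y. ennreal (\<Prod>j\<in>S. f j (u j \<bullet> y) powr d j) \<partial>lebesgue)"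
    by (simp add: nn_integral_completion)
  also have "\<dots> \<le> (\<integral>\<^sup>+y. ennreal (?C * ?G y) \<partial>lebesgue)"
    by (intro nn_integral_mono ennreal_leI key)
  also have "\<dots> = ennreal (\<integral>y. ?C * ?G y \<partial>lebesgue)"
    using G(1) \<gamma>_nonneg by (intro nn_integral_eq_integral) (auto intro!: mult_nonneg_nonneg prod_nonneg)
  also have "\<dots> = ennreal (?C * b)" using G(2) by simp
  also have "\<dots> \<le> ennreal ?C"
    using b by (intro ennreal_leI mult_left_le prod_nonneg) auto
  finally show ?thesis by (simp add: C_def)
qed

section \<open>Powers of the sinc function\<close>

text \<open>Near 0 the integrand is at most 1, and for large \<open>\<bar>x\<bar>\<close> it is at most \<open>\<bar>x\<bar> powr - p\<close>.\<close>

lemma integrable_sinc_powr: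
  fixes p :: real
  assumes p: "1 < p"
  shows "integrable lborel (\<lambda>x. \<bar>sinc x\<bar> powr p)"
proof -
  \<comment> \<open>the tail of the majorant; the other side is its reflection\<close>
  define h where "h x = indicator {1..} x * x powr - p" for x :: real
  have hm: "h \<in> borel_measurable borel" unfolding h_def by measurable
  have "(\<lambda>x. x powr - p) integrable_on {1..}"
    using has_integral_powr_to_inf[of "- p" 1] p by (auto simp: integrable_on_def)
  then have "(\<lambda>x. x powr - p) absolutely_integrable_on {1..}"
    by (rule nonnegative_absolutely_integrable_1) simp
  then have h: "integrable lborel h"
    using hm by (simp add: set_integrable_def h_def[abs_def] integrable_completion)
  have h': "integrable lborel (\<lambda>x. h (0 + (-1) * x))"
    using h by (rule lborel_integrable_real_affine) simp
  have "integrable lborel (\<lambda>x. indicator {-1..1} x + h x + h (0 + (-1) * x))"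
    using h h' by (intro Bochner_Integration.integrable_add) auto
  then show ?thesis
  proof (rule Bochner_Integration.integrable_bound)
    show "(\<lambda>x. \<bar>sinc x\<bar> powr p) \<in> borel_measurable lborel" by measurable
    have "\<bar>sinc x\<bar> powr p \<le> indicator {-1..1} x + h x + h (- x)" for x
    proof -
      have h0: "0 \<le> h y" for y by (simp add: h_def)
      have s1: "\<bar>sinc x\<bar> \<le> 1"
        using abs_sin_x_le_abs_x[of x] by (simp add: divide_simps)
      consider "\<bar>x\<bar> \<le> 1" | "1 < \<bar>x\<bar>" by linarith
      then show ?thesis
      proof cases
        case 1
        then have "\<bar>sinc x\<bar> powr p \<le> indicator {-1..1} x"
          using s1 p powr_mono2[of p "\<bar>sinc x\<bar>" 1] by (simp add: indicator_def abs_le_iff)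
        then show ?thesis using h0[of x] h0[of "- x"] by linarith
      next
        case 2
        then have "\<bar>sinc x\<bar> \<le> 1 / \<bar>x\<bar>" by (auto simp: divide_simps)
        then have "\<bar>sinc x\<bar> powr p \<le> (1 / \<bar>x\<bar>) powr p" using p by (intro powr_mono2) auto
        also have "\<dots> = \<bar>x\<bar> powr - p" by (simp add: powr_divide powr_minus_divide)
        also have "\<dots> \<le> h x + h (- x)"
          using 2 by (auto simp: h_def indicator_def abs_if)
        finally have "\<bar>sinc x\<bar> powr p \<le> h x + h (- x)" .
        moreover have "0 \<le> (indicator {-1..1} x :: real)" by simp
        ultimately show ?thesis by linarith
      qed
    qed
    moreover have "0 \<le> indicator {-1..1} x + h x + h (- x)" for x by (simp add: h_def)
    ultimately show "AE x in lborel. norm (\<bar>sinc x\<bar> powr p) \<le> norm (indicator {-1..1} x + h x + h (0 + (-1) * x))"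
      by simp
  qed
qed

lemma sinc_integral_eq: "sinc_integral p = (\<integral>x. \<bar>sinc x\<bar> powr p \<partial>lborel)"
  unfolding sinc_integral_def
  by (intro integral_cong_AE AE_I[of _ _ "{0}"]) auto

lemma has_bochner_integral_sinc_scaled:
  fixes p k :: real
  assumes p: "1 < p" and k: "0 < k"
  shows "has_bochner_integral lborel (\<lambda>x. \<bar>sinc (k * x)\<bar> powr p) (sinc_integral p / k)"
proof -
  have i: "integrable lborel (\<lambda>x. \<bar>sinc (0 + k * x)\<bar> powr p)"
    using integrable_sinc_powr[OF p] k by (intro lborel_integrable_real_affine) auto
  have "sinc_integral p = \<bar>k\<bar> *\<^sub>R (\<integral>x. \<bar>sinc (0 + k * x)\<bar> powr p \<partial>lborel)"
    unfolding sinc_integral_eq using k by (intro lborel_integral_real_affine) auto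
  with i k show ?thesis unfolding add_0_left has_bochner_integral_iff by simp
qed

text \<open>The sinc factors depend on \<open>y\<close> through its projection to \<open>span C\<close> only, so this is an integral over \<open>span C\<close>,
written over the whole space by means of Gaussian factors along \<open>B\<close>. The vectors of
\<open>B\<close> complete the normalised projections of the unit vectors to a tight frame of the whole space, with
weights 1 and \<open>r e\<close>. As
\<open>r e < 1\<close>, the exponents \<open>1 / r e\<close> exceed 1 and the sinc integrals converge.\<close>

lemma sinc_product_bound:
  fixes B C :: "(real^'n::{finite,wellorder}) set"
  assumes D: "orthonormal_basis_of UNIV (B \<union> C)" and dis: "B \<inter> C = {}"
    and a: "\<And>e. e \<in> Basis \<Longrightarrow> 0 < a \<bullet> e"
    and r: "\<And>e. e \<in> Basis \<Longrightarrow> r e = (norm (proj_span C e))\<^sup>2"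
    and r1: "\<And>e. e \<in> Basis \<Longrightarrow> r e < 1"
  shows "(\<integral>\<^sup>+y. ennreal ((\<Prod>b\<in>B. std_normal_density (b \<bullet> y)) *
          (\<Prod>e\<in>Basis. \<bar>sinc ((a \<bullet> e) * (e \<bullet> proj_span C y))\<bar>)) \<partial>lborel)
    \<le> ennreal (\<Prod>e | e \<in> Basis \<and> r e \<noteq> 0. (sinc_integral (1 / r e) / ((a \<bullet> e) * sqrt (r e))) powr r e)"
proof -
  have fin: "finite B" "finite C" using orthonormal_basis_of_finite[OF D] by auto
  have onC: "pairwise orthogonal C" "\<forall>b\<in>C. norm b = 1" and nB: "\<And>b. b \<in> B \<Longrightarrow> norm b = 1"
    using D by (auto simp: orthonormal_basis_of_def intro: pairwise_subset)
  let ?P = "proj_span C"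
  define A where "A = {e \<in> Basis. r e \<noteq> 0}"
  have A: "finite A" "A \<subseteq> Basis" by (auto simp: A_def)
  have rpos: "0 < r e" if "e \<in> A" for e using that r by (auto simp: A_def less_le)
  have Pe: "e \<bullet> ?P y = ?P e \<bullet> y" for e y by (rule inner_proj_span_commute)
  have zero: "e \<bullet> ?P y = 0" if "e \<in> Basis" "e \<notin> A" for e y
    using that r by (auto simp: A_def Pe)
  \<comment> \<open>For \<open>e\<close> orthogonal to \<open>span C\<close> the factor is \<open>sinc 0 = 1\<close>; the remaining ones, together with the
    Gaussians along \<open>B\<close>, form a tight frame of the whole space.\<close>
  define u where "u = (\<lambda>j. case j of Inl e \<Rightarrow> ?P e /\<^sub>R sqrt (r e) | Inr b \<Rightarrow> b)"
  define d where "d = (\<lambda>j. case j of Inl e \<Rightarrow> r e | Inr (b :: real^'n::_) \<Rightarrow> 1)"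
  have uP: "sqrt (r e) * (u (Inl e) \<bullet> y) = e \<bullet> ?P y" if "e \<in> A" for e y
    using rpos[OF that] by (simp add: u_def Pe)
  have frame: "(\<Sum>j\<in>A <+> B. d j * (u j \<bullet> x)\<^sup>2) = x \<bullet> x" for x
  proof -
    have "(\<Sum>e\<in>A. d (Inl e) * (u (Inl e) \<bullet> x)\<^sup>2) = (\<Sum>e\<in>A. (e \<bullet> ?P x)\<^sup>2)"
    proof (rule sum.cong)
      fix e assume e: "e \<in> A"
      have "d (Inl e) * (u (Inl e) \<bullet> x)\<^sup>2 = (sqrt (r e) * (u (Inl e) \<bullet> x))\<^sup>2"
        using rpos[OF e] by (simp add: d_def power_mult_distrib)
      then show "d (Inl e) * (u (Inl e) \<bullet> x)\<^sup>2 = (e \<bullet> ?P x)\<^sup>2" using uP[OF e] by simp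
    qed simp
    also have "\<dots> = (\<Sum>e\<in>Basis. (e \<bullet> ?P x)\<^sup>2)"
      using A zero by (intro sum.mono_neutral_left) auto
    also have "\<dots> = (\<Sum>d\<in>C. (d \<bullet> x)\<^sup>2)"
    proof -
      have "(\<Sum>e\<in>Basis. (e \<bullet> ?P x)\<^sup>2) = ?P x \<bullet> ?P x"
        by (rule orthonormal_basis_Parseval[OF orthonormal_basis_of_Basis])
      also have "\<dots> = x \<bullet> ?P x" by (rule proj_span_orthonormal[OF fin(2) onC])
      also have "\<dots> = (\<Sum>d\<in>C. (d \<bullet> x)\<^sup>2)" by (simp add: inner_proj_span power2_eq_square)
      finally show ?thesis .
    qed
    finally have "(\<Sum>j\<in>A <+> B. d j * (u j \<bullet> x)\<^sup>2) = (\<Sum>d\<in>C. (d \<bullet> x)\<^sup>2) + (\<Sum>b\<in>B. (b \<bullet> x)\<^sup>2)"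
      using A fin by (simp add: sum.Plus d_def u_def)
    also have "\<dots> = (\<Sum>b\<in>B \<union> C. (b \<bullet> x)\<^sup>2)"
      using fin dis by (simp add: sum.union_disjoint)
    finally show ?thesis by (simp add: orthonormal_basis_Parseval[OF D])
  qed
  have unit: "norm (u j) = 1" if "j \<in> A <+> B" for j
  proof (cases j)
    case (Inl e)
    then have "e \<in> A" using that by auto
    then have "0 < r e" "sqrt (r e) = norm (?P e)" using rpos r A by auto
    moreover from this have "norm (?P e) \<noteq> 0" by (metis less_irrefl real_sqrt_gt_zero)
    ultimately show ?thesis using Inl by (simp add: u_def)
  next
    case (Inr b)
    then show ?thesis using that nB by (auto simp: u_def)
  qed
  have dpos: "0 < d j" if "j \<in> A <+> B" for j
    using that rpos by (auto simp: d_def)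
  let ?I = "\<lambda>e. sinc_integral (1 / r e) / ((a \<bullet> e) * sqrt (r e))"
  let ?k = "\<lambda>e. (a \<bullet> e) * sqrt (r e)"
  have k: "0 < ?k e" if "e \<in> A" for e using a rpos[OF that] A that by (auto intro!: mult_pos_pos)
  have p: "1 < 1 / r e" if "e \<in> A" for e using rpos[OF that] r1 A that by auto
  let ?L = "\<integral>\<^sup>+y. ennreal ((\<Prod>b\<in>B. std_normal_density (b \<bullet> y)) *
          (\<Prod>e\<in>Basis. \<bar>sinc ((a \<bullet> e) * (e \<bullet> ?P y))\<bar>)) \<partial>lborel"
  \<comment> \<open>\<open>sinc\<close> has zeros whereas the Brascamp-Lieb inequality needs positive functions: a small Gaussian
    is added and removed in the limit.\<close>
  have bound: "?L \<le> ennreal (\<Prod>e\<in>A. (?I e + \<delta>) powr r e)" if \<delta>: "0 < \<delta>" for \<delta>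
  proof -
    define f where "f = (\<lambda>j s. case j of
        Inl e \<Rightarrow> \<bar>sinc (?k e * s)\<bar> powr (1 / r e) + \<delta> * std_normal_density s
      | Inr (b :: real^'n::_) \<Rightarrow> std_normal_density s)"
    have cn: "continuous_on UNIV std_normal_density"
      unfolding std_normal_density_def by (intro continuous_intros) auto
    have cs: "continuous_on UNIV (\<lambda>s. \<bar>sinc (?k e * s)\<bar> powr (1 / r e) + \<delta> * std_normal_density s)" if "e \<in> A" for e
      by (intro continuous_on_add continuous_on_powr' continuous_on_rabs continuous_on_sinc
          continuous_on_mult continuous_on_const continuous_on_id cn) (use rpos[OF that] in auto)
    have f_int: "has_bochner_integral lborel (f (Inl e)) (?I e + \<delta> * 1)" if "e \<in> A" for e
      unfolding f_def sum.case
      by (intro has_bochner_integral_add has_bochner_integral_sinc_scaled p k that has_bochner_integral_mult_right)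
        (simp add: has_bochner_integral_iff)
    have "?L \<le> (\<integral>\<^sup>+y. ennreal (\<Prod>j\<in>A <+> B. f j (u j \<bullet> y) powr d j) \<partial>lborel)"
    proof (intro nn_integral_mono ennreal_leI)
      fix y
      have "(\<Prod>e\<in>Basis. \<bar>sinc ((a \<bullet> e) * (e \<bullet> ?P y))\<bar>) = (\<Prod>e\<in>A. \<bar>sinc ((a \<bullet> e) * (e \<bullet> ?P y))\<bar>)"
        using A zero by (intro prod.mono_neutral_right) auto
      also have "\<dots> \<le> (\<Prod>e\<in>A. f (Inl e) (u (Inl e) \<bullet> y) powr d (Inl e))"
      proof (intro prod_mono conjI abs_ge_zero)
        fix e assume e: "e \<in> A"
        let ?s = "\<bar>sinc (?k e * (u (Inl e) \<bullet> y))\<bar>"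
        have "(a \<bullet> e) * (e \<bullet> ?P y) = ?k e * (u (Inl e) \<bullet> y)"
          unfolding uP[OF e, symmetric] by simp
        then have "\<bar>sinc ((a \<bullet> e) * (e \<bullet> ?P y))\<bar> = ?s" by (simp only:)
        also have "\<dots> = (?s powr (1 / r e)) powr r e"
          using rpos[OF e] by (simp add: powr_powr)
        also have "\<dots> \<le> f (Inl e) (u (Inl e) \<bullet> y) powr r e"
          unfolding f_def sum.case using rpos[OF e] \<delta> by (intro powr_mono2) auto
        finally show "\<bar>sinc ((a \<bullet> e) * (e \<bullet> ?P y))\<bar> \<le> f (Inl e) (u (Inl e) \<bullet> y) powr d (Inl e)"
          by (simp add: d_def)
      qed
      finally have le: "(\<Prod>b\<in>B. std_normal_density (b \<bullet> y)) * (\<Prod>e\<in>Basis. \<bar>sinc ((a \<bullet> e) * (e \<bullet> ?P y))\<bar>)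
          \<le> (\<Prod>b\<in>B. std_normal_density (b \<bullet> y)) * (\<Prod>e\<in>A. f (Inl e) (u (Inl e) \<bullet> y) powr d (Inl e))"
        by (intro mult_left_mono prod_nonneg) auto
      have "(\<Prod>j\<in>A <+> B. f j (u j \<bullet> y) powr d j)
          = (\<Prod>e\<in>A. f (Inl e) (u (Inl e) \<bullet> y) powr d (Inl e)) * (\<Prod>b\<in>B. f (Inr b) (u (Inr b) \<bullet> y) powr d (Inr b))"
        using A fin by (simp add: prod.Plus)
      also have "(\<Prod>b\<in>B. f (Inr b) (u (Inr b) \<bullet> y) powr d (Inr b)) = (\<Prod>b\<in>B. std_normal_density (b \<bullet> y))"
        by (simp add: f_def u_def d_def)
      finally have "(\<Prod>j\<in>A <+> B. f j (u j \<bullet> y) powr d j)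
          = (\<Prod>b\<in>B. std_normal_density (b \<bullet> y)) * (\<Prod>e\<in>A. f (Inl e) (u (Inl e) \<bullet> y) powr d (Inl e))"
        by (simp only: mult.commute)
      with le show "(\<Prod>b\<in>B. std_normal_density (b \<bullet> y)) * (\<Prod>e\<in>Basis. \<bar>sinc ((a \<bullet> e) * (e \<bullet> ?P y))\<bar>)
          \<le> (\<Prod>j\<in>A <+> B. f j (u j \<bullet> y) powr d j)"
        by (simp only:)
    qed
    also have "\<dots> \<le> ennreal (\<Prod>j\<in>A <+> B. (\<integral>x. f j x \<partial>lborel) powr d j)"
    proof (rule geometric_Brascamp_Lieb)
      show "finite (A <+> B)" using A fin by simp
      fix j assume j: "j \<in> A <+> B"
      show "norm (u j) = 1" using j by (rule unit)
      show "0 < d j" using j by (rule dpos)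
      show "continuous_on UNIV (f j)"
        using j cs cn by (cases j) (auto simp: f_def simp del: mult_eq_0_iff)
      show "0 < f j x" for x
        using \<delta> by (auto simp: f_def normal_density_pos intro!: add_nonneg_pos mult_pos_pos split: sum.split)
      show "integrable lborel (f j)"
        using j f_int by (auto simp: has_bochner_integral_iff) (simp add: f_def)
    qed (rule frame)
    also have "(\<Prod>j\<in>A <+> B. (\<integral>x. f j x \<partial>lborel) powr d j) = (\<Prod>e\<in>A. (?I e + \<delta>) powr r e)"
    proof -
      have "(\<Prod>e\<in>A. (\<integral>x. f (Inl e) x \<partial>lborel) powr d (Inl e)) = (\<Prod>e\<in>A. (?I e + \<delta>) powr r e)"
        using f_int by (intro prod.cong) (auto simp: has_bochner_integral_iff d_def)
      moreover have "(\<Prod>b\<in>B. (\<integral>x. f (Inr b) x \<partial>lborel) powr d (Inr b)) = 1"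
        by (simp add: f_def d_def)
      ultimately show ?thesis using A fin by (simp add: prod.Plus)
    qed
    finally show ?thesis .
  qed
  have "(\<lambda>n. ennreal (\<Prod>e\<in>A. (?I e + inverse (real (Suc n))) powr r e)) \<longlonglongrightarrow> ennreal (\<Prod>e\<in>A. (?I e + 0) powr r e)"
  proof (intro tendsto_ennrealI tendsto_prod)
    fix e assume e: "e \<in> A"
    have nonneg: "0 \<le> ?I e"
      using k[OF e] by (auto simp: sinc_integral_def intro!: divide_nonneg_pos integral_nonneg_AE)
    show "(\<lambda>n. (?I e + inverse (real (Suc n))) powr r e) \<longlonglongrightarrow> (?I e + 0) powr r e"
      using rpos[OF e] nonneg
      by (intro tendsto_powr' tendsto_intros LIMSEQ_inverse_real_of_nat) (auto intro!: always_eventually)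
  qed
  then have "?L \<le> ennreal (\<Prod>e\<in>A. (?I e + 0) powr r e)"
    by (rule tendsto_lowerbound) (use bound in \<open>auto intro!: always_eventually\<close>)
  then show ?thesis by (simp add: A_def)
qed

section \<open>Fourier transforms of boxes and Gaussians\<close>

lemma integral_box_iexp:
  fixes \<alpha> z :: real
  assumes "0 \<le> \<alpha>"
  shows "has_bochner_integral lborel (\<lambda>s. indicator {-\<alpha>..\<alpha>} s *\<^sub>R iexp (s * z)) (of_real (2 * \<alpha> * sinc (\<alpha> * z)))"
proof (cases "z = 0")
  case True
  have "has_bochner_integral lborel (\<lambda>s. indicator {-\<alpha>..\<alpha>} s *\<^sub>R iexp (s * z)) (of_real \<alpha> - of_real (- \<alpha>))"
    by (rule has_bochner_integral_FTC_Icc)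
      (use assms True in \<open>auto intro!: derivative_eq_intros continuous_intros simp: of_real_def\<close>)
  then show ?thesis using True by simp
next
  case False
  let ?F = "\<lambda>s. iexp (s * z) / (\<i> * z)"
  have "has_bochner_integral lborel (\<lambda>s. indicator {-\<alpha>..\<alpha>} s *\<^sub>R iexp (s * z)) (?F \<alpha> - ?F (- \<alpha>))"
  proof (rule has_bochner_integral_FTC_Icc)
    fix s
    have "((\<lambda>s. exp (\<i> * (s * complex_of_real z)) / (\<i> * z)) has_field_derivative iexp (s * z)) (at (complex_of_real s))" for s
      using False by (auto intro!: derivative_eq_intros simp: mult.commute[of _ \<i>])
    then have "((\<lambda>s. exp (\<i> * (complex_of_real s * complex_of_real z)) / (\<i> * z)) has_vector_derivative iexp (s * z))
        (at s within {-\<alpha>..\<alpha>})"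
      by (rule has_vector_derivative_real_field)
    then show "(?F has_vector_derivative iexp (s * z)) (at s within {-\<alpha>..\<alpha>})" by simp
  qed (use assms in \<open>auto intro!: continuous_intros\<close>)
  moreover have "?F \<alpha> - ?F (- \<alpha>) = of_real (2 * \<alpha> * sinc (\<alpha> * z))"
    using False
    by (auto simp: exp_Euler sin_of_real cos_of_real divide_simps simp del: of_real_mult simp flip: of_real_minus)
      (auto simp: algebra_simps)
  ultimately show ?thesis by simp
qed

lemma integral_gaussian_iexp:
  fixes \<sigma> t :: real
  assumes \<sigma>: "0 < \<sigma>"
  shows "has_bochner_integral lborel (\<lambda>s. of_real (exp (- (\<sigma> * s)\<^sup>2 / 2)) * iexp (s * t))
           (of_real (2 * pi * normal_density 0 \<sigma> t))"
proof -
  \<comment> \<open>The substitution \<open>s \<mapsto> \<sigma> s\<close> reduces to the characteristic function of the standard normal law.\<close>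
  define g where "g s = of_real (std_normal_density s) * iexp (t / \<sigma> * s)" for s
  have m: "g \<in> borel_measurable borel" unfolding g_def by measurable
  have gi: "integrable lborel g"
  proof (rule Bochner_Integration.integrable_bound)
    show "integrable lborel std_normal_density" by simp
  qed (use m in \<open>auto simp: g_def norm_mult\<close>)
  have gv: "(\<integral>s. g s \<partial>lborel) = of_real (exp (- (t / \<sigma>)\<^sup>2 / 2))"
  proof -
    have "(\<integral>s. g s \<partial>lborel) = char std_normal_distribution (t / \<sigma>)"
      unfolding char_def g_def by (subst integral_density) (auto simp: scaleR_conv_of_real)
    then show ?thesis by (simp add: char_std_normal_distribution)
  qed
  have eq: "of_real (exp (- (\<sigma> * s)\<^sup>2 / 2)) * iexp (s * t) = of_real (sqrt (2 * pi)) * g (0 + \<sigma> * s)" for s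
  proof -
    have "exp (- (\<sigma> * s)\<^sup>2 / 2) = sqrt (2 * pi) * std_normal_density (\<sigma> * s)"
      by (simp add: std_normal_density_def)
    moreover have "t / \<sigma> * (\<sigma> * s) = s * t" using \<sigma> by simp
    ultimately show ?thesis by (simp only: g_def add_0_left of_real_mult mult.assoc)
  qed
  have int: "integrable lborel (\<lambda>s. g (0 + \<sigma> * s))"
    using gi \<sigma> by (intro lborel_integrable_real_affine) auto
  have "(\<integral>s. g s \<partial>lborel) = \<bar>\<sigma>\<bar> *\<^sub>R (\<integral>s. g (0 + \<sigma> * s) \<partial>lborel)"
    using \<sigma> by (intro lborel_integral_real_affine) auto
  then have "(\<integral>s. g (0 + \<sigma> * s) \<partial>lborel) = of_real (exp (- (t / \<sigma>)\<^sup>2 / 2) / \<sigma>)"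
    using \<sigma> gv by (simp add: scaleR_conv_of_real field_simps)
  then have "has_bochner_integral lborel (\<lambda>s. of_real (sqrt (2 * pi)) * g (0 + \<sigma> * s))
      (of_real (sqrt (2 * pi)) * of_real (exp (- (t / \<sigma>)\<^sup>2 / 2) / \<sigma>))"
    using int by (intro has_bochner_integral_mult_right) (auto simp: has_bochner_integral_iff)
  moreover have "sqrt (2 * pi) * (exp (- (t / \<sigma>)\<^sup>2 / 2) / \<sigma>) = 2 * pi * normal_density 0 \<sigma> t"
  proof -
    have "2 * pi = sqrt (2 * pi) * sqrt (2 * pi)" by simp
    then show ?thesis using \<sigma>
      by (simp add: normal_density_def real_sqrt_mult power_divide divide_simps)
  qed
  ultimately show ?thesis unfolding eq by (simp only: of_real_mult[symmetric])
qed

lemma indicator_cbox_symmetric: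
  fixes a x :: "'a::euclidean_space"
  shows "(indicator (cbox (-a) a) x :: real) = (\<Prod>e\<in>Basis. indicator {- (a \<bullet> e)..a \<bullet> e} (e \<bullet> x))"
proof (cases "x \<in> cbox (-a) a")
  case True
  then show ?thesis by (auto simp: mem_box inner_commute indicator_def intro!: prod.neutral[symmetric])
next
  case False
  then obtain e where "e \<in> Basis" "\<not> (- (a \<bullet> e) \<le> x \<bullet> e \<and> x \<bullet> e \<le> a \<bullet> e)"
    by (auto simp: mem_box)
  then have "(\<Prod>e\<in>Basis. indicator {- (a \<bullet> e)..a \<bullet> e} (e \<bullet> x)) = (0::real)"
    by (intro prod_zero finite_Basis bexI[of _ e]) (auto simp: inner_commute indicator_def)
  then show ?thesis using False by simp
qed

lemma integral_cbox_iexp: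
  fixes a y :: "'a::euclidean_space"
  assumes a: "\<And>e. e \<in> Basis \<Longrightarrow> 0 \<le> a \<bullet> e"
  shows "(\<integral>x. indicator (cbox (-a) a) x *\<^sub>R iexp (x \<bullet> y) \<partial>lborel)
    = of_real (\<Prod>e\<in>Basis. 2 * (a \<bullet> e) * sinc ((a \<bullet> e) * (e \<bullet> y)))"
proof -
  have eq: "indicator (cbox (-a) a) x *\<^sub>R iexp (x \<bullet> y)
      = (\<Prod>e\<in>Basis. indicator {- (a \<bullet> e)..a \<bullet> e} (e \<bullet> x) *\<^sub>R iexp ((e \<bullet> x) * (e \<bullet> y)))" for x
  proof -
    have "iexp (x \<bullet> y) = (\<Prod>e\<in>Basis. iexp ((e \<bullet> x) * (e \<bullet> y)))"
      unfolding euclidean_inner[of x y] of_real_sum sum_distrib_left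
      by (subst exp_sum) (auto simp: inner_commute)
    then show ?thesis
      by (simp add: indicator_cbox_symmetric scaleR_conv_of_real prod.distrib)
  qed
  show ?thesis
    unfolding eq using integral_box_iexp[OF a]
    by (subst integral_coordinate_prod[OF orthonormal_basis_of_Basis, of "\<lambda>e s. indicator {- (a \<bullet> e)..a \<bullet> e} s *\<^sub>R iexp (s * (e \<bullet> y))"])
      (auto simp: has_bochner_integral_iff of_real_prod)
qed

text \<open>The Gaussian along \<open>C\<close> is replaced by the integral of its Fourier transform; after exchanging the
integrals the box contributes its own Fourier transform, a product of sinc functions, evaluated at
the projection of \<open>y\<close>. Taking absolute values then loses the oscillation.\<close>

lemma gaussian_slab_Fourier_bound:
  fixes B C :: "'a::euclidean_space set"
  assumes D: "orthonormal_basis_of UNIV (B \<union> C)" and dis: "B \<inter> C = {}"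
    and a: "\<And>e. e \<in> Basis \<Longrightarrow> 0 \<le> a \<bullet> e" and \<sigma>: "0 < \<sigma>"
  shows "(\<integral>\<^sup>+x. ennreal (indicator (cbox (-a) a) x * (\<Prod>d\<in>C. normal_density 0 \<sigma> (d \<bullet> x))) \<partial>lborel)
    \<le> ennreal ((\<Prod>e\<in>Basis. 2 * (a \<bullet> e)) / (2 * pi) ^ card C) *
      (\<integral>\<^sup>+y. ennreal ((\<Prod>b\<in>B. std_normal_density (b \<bullet> y)) *
          (\<Prod>e\<in>Basis. \<bar>sinc ((a \<bullet> e) * (e \<bullet> proj_span C y))\<bar>)) \<partial>lborel)"
proof -
  have fin: "finite B" "finite C" using orthonormal_basis_of_finite[OF D] by auto
  \<comment> \<open>Up to a constant, the first product is the Fourier transform of the Gaussian on \<open>span C\<close>; the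
    densities along \<open>B\<close> have mass 1 and turn an integral over \<open>span C\<close> into one over the whole space.\<close>
  define w where "w y = (\<Prod>d\<in>C. exp (- (\<sigma> * (d \<bullet> y))\<^sup>2 / 2)) * (\<Prod>b\<in>B. std_normal_density (b \<bullet> y))" for y
  have w_nonneg: "0 \<le> w y" for y unfolding w_def by (intro mult_nonneg_nonneg prod_nonneg) auto
  have w_le: "w y \<le> (\<Prod>b\<in>B. std_normal_density (b \<bullet> y))" for y
    unfolding w_def by (intro mult_left_le_one_le prod_nonneg prod_le_1) auto
  let ?Q = "cbox (-a) a"
  define G where "G x y = (indicator ?Q x * w y) *\<^sub>R iexp (x \<bullet> proj_span C y)" for x y
  define h where "h x d s = (if d \<in> C then of_real (exp (- (\<sigma> * s)\<^sup>2 / 2)) * iexp (s * (d \<bullet> x))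
      else of_real (std_normal_density s))" for x d s
  have hb: "has_bochner_integral lborel (h x d)
      (if d \<in> C then of_real (2 * pi * normal_density 0 \<sigma> (d \<bullet> x)) else 1)" for x d
    unfolding h_def using integral_gaussian_iexp[OF \<sigma>, of "d \<bullet> x"]
    by (auto simp: has_bochner_integral_iff complex_of_real_integrable_eq)
  have split: "(\<Prod>d\<in>B \<union> C. k d) = (\<Prod>d\<in>B. k d) * (\<Prod>d\<in>C. k d)" for k :: "'a \<Rightarrow> complex"
    by (rule prod.union_disjoint[OF fin dis])
  have notC: "b \<notin> C" if "b \<in> B" for b using that dis by auto
  have hprod: "(\<Prod>d\<in>B \<union> C. h x d (d \<bullet> y)) = w y *\<^sub>R iexp (x \<bullet> proj_span C y)" for x y
  proof -
    have "(\<Prod>d\<in>C. iexp ((d \<bullet> y) * (d \<bullet> x))) = iexp (x \<bullet> proj_span C y)"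
      unfolding inner_proj_span of_real_sum sum_distrib_left
      by (subst exp_sum) (auto simp: fin mult.commute)
    moreover have "(\<Prod>d\<in>C. h x d (d \<bullet> y)) = (\<Prod>d\<in>C. of_real (exp (- (\<sigma> * (d \<bullet> y))\<^sup>2 / 2))) * (\<Prod>d\<in>C. iexp ((d \<bullet> y) * (d \<bullet> x)))"
      unfolding prod.distrib[symmetric] by (intro prod.cong) (auto simp: h_def)
    moreover have "(\<Prod>b\<in>B. h x b (b \<bullet> y)) = (\<Prod>b\<in>B. of_real (std_normal_density (b \<bullet> y)))"
      using notC by (intro prod.cong) (auto simp: h_def)
    ultimately show ?thesis
      unfolding split w_def by (simp add: scaleR_conv_of_real)
  qed
  have hint: "integrable lborel (\<lambda>y. w y *\<^sub>R iexp (x \<bullet> proj_span C y))" for x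
    unfolding hprod[symmetric] using hb by (intro integrable_coordinate_prod[OF D]) (auto simp: has_bochner_integral_iff)
  have w_int: "integrable lborel w"
    using integrable_norm[OF hint[of 0]] w_nonneg by simp
  have inner: "(\<integral>y. G x y \<partial>lborel) = of_real ((2 * pi) ^ card C * (indicator ?Q x * (\<Prod>d\<in>C. normal_density 0 \<sigma> (d \<bullet> x))))" for x
  proof -
    have "(\<integral>y. w y *\<^sub>R iexp (x \<bullet> proj_span C y) \<partial>lborel)
        = (\<Prod>d\<in>B \<union> C. if d \<in> C then of_real (2 * pi * normal_density 0 \<sigma> (d \<bullet> x)) else 1)"
      unfolding hprod[symmetric] using hb
      by (subst integral_coordinate_prod[OF D]) (auto simp: has_bochner_integral_iff intro!: prod.cong)
    also have "\<dots> = (\<Prod>d\<in>C. of_real (2 * pi * normal_density 0 \<sigma> (d \<bullet> x)))"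
      unfolding split using notC by simp
    also have "\<dots> = of_real ((2 * pi) ^ card C * (\<Prod>d\<in>C. normal_density 0 \<sigma> (d \<bullet> x)))"
      by (simp add: prod.distrib)
    finally show ?thesis
      unfolding G_def scaleR_scaleR[symmetric] by (simp add: scaleR_conv_of_real)
  qed
  have Gm: "(\<lambda>(x, y). G x y) \<in> borel_measurable (lborel \<Otimes>\<^sub>M lborel)"
    unfolding G_def w_def proj_span_def by measurable
  have indQ: "integrable lborel (indicator ?Q :: 'a \<Rightarrow> real)"
    by (simp add: emeasure_lborel_cbox_eq)
  have norm_G: "norm (G x y) = indicator ?Q x * w y" for x y
    using w_nonneg by (simp add: G_def)
  have Gint: "integrable (lborel \<Otimes>\<^sub>M lborel) (\<lambda>(x, y). G x y)"
  proof (rule lborel_pair.Fubini_integrable[OF Gm])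
    show "integrable lborel (\<lambda>x. \<integral>y. norm ((\<lambda>(x, y). G x y) (x, y)) \<partial>lborel)"
      using indQ by (simp add: norm_G)
    show "AE x in lborel. integrable lborel (\<lambda>y. (\<lambda>(x, y). G x y) (x, y))"
      unfolding G_def using hint by (simp add: scaleR_scaleR[symmetric] del: scaleR_scaleR)
  qed
  have swap: "(\<integral>x. (\<integral>y. G x y \<partial>lborel) \<partial>lborel) = (\<integral>y. (\<integral>x. G x y \<partial>lborel) \<partial>lborel)"
    using lborel_pair.Fubini_integral[OF Gint] by simp
  define R where "R y = (\<Prod>e\<in>Basis. 2 * (a \<bullet> e) * sinc ((a \<bullet> e) * (e \<bullet> proj_span C y)))" for y
  have outer: "(\<integral>x. G x y \<partial>lborel) = of_real (w y * R y)" for y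
  proof -
    have "(\<integral>x. G x y \<partial>lborel) = (\<integral>x. w y *\<^sub>R (indicator ?Q x *\<^sub>R iexp (x \<bullet> proj_span C y)) \<partial>lborel)"
      by (simp add: G_def mult.commute)
    also have "\<dots> = w y *\<^sub>R (\<integral>x. indicator ?Q x *\<^sub>R iexp (x \<bullet> proj_span C y) \<partial>lborel)"
      by (rule integral_scaleR_right)
    also have "(\<integral>x. indicator ?Q x *\<^sub>R iexp (x \<bullet> proj_span C y) \<partial>lborel) = of_real (R y)"
      unfolding R_def by (rule integral_cbox_iexp[OF a])
    finally show ?thesis by (simp add: scaleR_conv_of_real)
  qed
  let ?f = "\<lambda>x. indicator ?Q x * (\<Prod>d\<in>C. normal_density 0 \<sigma> (d \<bullet> x))"
  have f_nonneg: "0 \<le> ?f x" for x by (intro mult_nonneg_nonneg prod_nonneg) auto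
  let ?c = "(2 * pi) ^ card C"
  have "integrable lborel (\<lambda>x. \<integral>y. G x y \<partial>lborel)"
    using lborel_pair.integrable_fst'[OF Gint] by simp
  then have "integrable lborel (\<lambda>x. ?c * ?f x)"
    unfolding inner complex_of_real_integrable_eq .
  then have f_int: "integrable lborel ?f" by simp
  have wR: "integrable lborel (\<lambda>y. w y * R y)"
  proof -
    have "integrable lborel (\<lambda>y. \<integral>x. G x y \<partial>lborel)"
      using lborel_pair.integrable_snd[of "\<lambda>x y. G x y"] Gint by (simp add: case_prod_beta')
    then show ?thesis unfolding outer complex_of_real_integrable_eq .
  qed
  have "?c * (\<integral>x. ?f x \<partial>lborel) = (\<integral>y. w y * R y \<partial>lborel)"
  proof -
    have "complex_of_real (\<integral>x. ?c * ?f x \<partial>lborel) = complex_of_real (\<integral>y. w y * R y \<partial>lborel)"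
      using swap unfolding inner outer by (simp only: integral_complex_of_real)
    then show ?thesis by (simp only: of_real_eq_iff integral_mult_right_zero)
  qed
  then have "(\<integral>x. ?f x \<partial>lborel) = (\<integral>y. w y * R y / ?c \<partial>lborel)"
    by (simp add: field_simps)
  also have "\<dots> \<le> norm (\<integral>y. w y * R y / ?c \<partial>lborel)"
    unfolding real_norm_def by (rule abs_ge_self)
  finally have "ennreal (\<integral>x. ?f x \<partial>lborel) \<le> ennreal (norm (\<integral>y. w y * R y / ?c \<partial>lborel))"
    by (rule ennreal_leI)
  also have "\<dots> \<le> (\<integral>\<^sup>+y. norm (w y * R y / ?c) \<partial>lborel)"
    using wR by (intro integral_norm_bound_ennreal) auto
  also have "\<dots> \<le> (\<integral>\<^sup>+y. ennreal ((\<Prod>e\<in>Basis. 2 * (a \<bullet> e)) / ?c) *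
      ennreal ((\<Prod>b\<in>B. std_normal_density (b \<bullet> y)) *
          (\<Prod>e\<in>Basis. \<bar>sinc ((a \<bullet> e) * (e \<bullet> proj_span C y))\<bar>)) \<partial>lborel)"
  proof (rule nn_integral_mono)
    fix y
    let ?s = "\<Prod>e\<in>Basis. \<bar>sinc ((a \<bullet> e) * (e \<bullet> proj_span C y))\<bar>"
    let ?A = "\<Prod>e\<in>Basis. 2 * (a \<bullet> e)"
    have A: "0 \<le> ?A" using a by (intro prod_nonneg) auto
    have "\<bar>R y\<bar> = ?A * ?s"
      unfolding R_def abs_prod prod.distrib[symmetric] using a by (intro prod.cong) (auto simp: abs_mult)
    then have "norm (w y * R y / ?c) = ?A / ?c * (w y * ?s)"
      using w_nonneg by (simp add: abs_mult)
    also have "\<dots> \<le> ?A / ?c * ((\<Prod>b\<in>B. std_normal_density (b \<bullet> y)) * ?s)"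
      using A w_le by (intro mult_left_mono mult_right_mono prod_nonneg) auto
    finally show "ennreal (norm (w y * R y / ?c)) \<le> ennreal (?A / ?c) * ennreal ((\<Prod>b\<in>B. std_normal_density (b \<bullet> y)) * ?s)"
      using A by (subst ennreal_mult[symmetric]) (auto intro!: ennreal_leI mult_nonneg_nonneg prod_nonneg)
  qed
  also have "\<dots> = ennreal ((\<Prod>e\<in>Basis. 2 * (a \<bullet> e)) / ?c) *
      (\<integral>\<^sup>+y. ennreal ((\<Prod>b\<in>B. std_normal_density (b \<bullet> y)) *
          (\<Prod>e\<in>Basis. \<bar>sinc ((a \<bullet> e) * (e \<bullet> proj_span C y))\<bar>)) \<partial>lborel)"
  proof (rule nn_integral_cmult)
    have "(\<lambda>y. sinc ((a \<bullet> e) * (e \<bullet> proj_span C y))) \<in> borel_measurable borel" for e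
      by (rule measurable_compose[OF _ borel_measurable_sinc]) (simp add: proj_span_def)
    then show "(\<lambda>y. ennreal ((\<Prod>b\<in>B. std_normal_density (b \<bullet> y)) *
        (\<Prod>e\<in>Basis. \<bar>sinc ((a \<bullet> e) * (e \<bullet> proj_span C y))\<bar>))) \<in> borel_measurable lborel"
      unfolding measurable_lborel2
      by (intro measurable_compose[OF _ measurable_ennreal] borel_measurable_times
          borel_measurable_prod borel_measurable_abs) auto
  qed
  finally show ?thesis
    using f_int f_nonneg by (subst nn_integral_eq_integral) auto
qed

section \<open>Sections of boxes\<close>

lemma std_normal_mass_limit:
  fixes \<eta> :: real
  assumes \<eta>: "0 < \<eta>"
  shows "(\<lambda>n. \<integral>\<^sup>+t. ennreal (indicator {-\<eta>..\<eta>} t * normal_density 0 (\<eta> / Suc n) t) \<partial>lborel) \<longlonglongrightarrow> 1"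
proof -
  interpret prob_space std_normal_distribution by (rule prob_space_normal_density) simp
  have "(\<integral>\<^sup>+t. ennreal (indicator {-\<eta>..\<eta>} t * normal_density 0 (\<eta> / Suc n) t) \<partial>lborel)
      = emeasure std_normal_distribution {- real (Suc n)..real (Suc n)}" for n
  proof -
    let ?\<sigma> = "\<eta> / Suc n"
    have \<sigma>: "0 < ?\<sigma>" using \<eta> by simp
    have "(\<integral>\<^sup>+t. ennreal (indicator {-\<eta>..\<eta>} t * normal_density 0 ?\<sigma> t) \<partial>lborel)
        = ennreal \<bar>?\<sigma>\<bar> * (\<integral>\<^sup>+t. ennreal (indicator {-\<eta>..\<eta>} (0 + ?\<sigma> * t) * normal_density 0 ?\<sigma> (0 + ?\<sigma> * t)) \<partial>lborel)"
      using \<sigma> by (intro nn_integral_real_affine) auto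
    also have "\<dots> = (\<integral>\<^sup>+t. ennreal ?\<sigma> * ennreal (indicator {-\<eta>..\<eta>} (0 + ?\<sigma> * t) * normal_density 0 ?\<sigma> (0 + ?\<sigma> * t)) \<partial>lborel)"
      unfolding abs_of_pos[OF \<sigma>] by (rule nn_integral_cmult[symmetric]) measurable
    also have "\<dots> = (\<integral>\<^sup>+t. ennreal (std_normal_density t) * indicator {- real (Suc n)..real (Suc n)} t \<partial>lborel)"
    proof (rule nn_integral_cong)
      fix t
      have "- \<eta> \<le> ?\<sigma> * t \<and> ?\<sigma> * t \<le> \<eta> \<longleftrightarrow> - real (Suc n) \<le> t \<and> t \<le> real (Suc n)"
      proof -
        have e: "?\<sigma> * real (Suc n) = \<eta>" by simp
        have "- \<eta> \<le> ?\<sigma> * t \<longleftrightarrow> ?\<sigma> * (- real (Suc n)) \<le> ?\<sigma> * t"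
          unfolding mult_minus_right e ..
        also have "\<dots> \<longleftrightarrow> - real (Suc n) \<le> t" using \<sigma> by (simp only: mult_le_cancel_left_pos)
        finally have 1: "- \<eta> \<le> ?\<sigma> * t \<longleftrightarrow> - real (Suc n) \<le> t" .
        have "?\<sigma> * t \<le> \<eta> \<longleftrightarrow> ?\<sigma> * t \<le> ?\<sigma> * real (Suc n)"
          unfolding e ..
        also have "\<dots> \<longleftrightarrow> t \<le> real (Suc n)" using \<sigma> by (simp only: mult_le_cancel_left_pos)
        finally show ?thesis using 1 by simp
      qed
      then have i: "indicator {-\<eta>..\<eta>} (?\<sigma> * t) = (indicator {- real (Suc n)..real (Suc n)} t :: real)"
        unfolding indicator_def atLeastAtMost_iff by simp
      have g: "?\<sigma> * normal_density 0 ?\<sigma> (?\<sigma> * t) = std_normal_density t"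
      proof -
        define s where "s = ?\<sigma>"
        have "0 < s" using \<sigma> by (simp add: s_def)
        then have "s * normal_density 0 s (s * t) = std_normal_density t"
          by (simp add: normal_density_def real_sqrt_mult power_mult_distrib)
        then show ?thesis unfolding s_def .
      qed
      have "ennreal ?\<sigma> * ennreal (indicator {-\<eta>..\<eta>} (0 + ?\<sigma> * t) * normal_density 0 ?\<sigma> (0 + ?\<sigma> * t))
          = ennreal (?\<sigma> * normal_density 0 ?\<sigma> (?\<sigma> * t) * indicator {- real (Suc n)..real (Suc n)} t)"
        unfolding add_0_left i using \<sigma> by (subst ennreal_mult[symmetric]) (auto simp: mult_ac)
      also have "\<dots> = ennreal (std_normal_density t) * indicator {- real (Suc n)..real (Suc n)} t"
        unfolding g by (simp add: indicator_def)
      finally show "ennreal ?\<sigma> * ennreal (indicator {-\<eta>..\<eta>} (0 + ?\<sigma> * t) * normal_density 0 ?\<sigma> (0 + ?\<sigma> * t))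
          = ennreal (std_normal_density t) * indicator {- real (Suc n)..real (Suc n)} t" .
    qed
    also have "\<dots> = emeasure std_normal_distribution {- real (Suc n)..real (Suc n)}"
      by (subst emeasure_density) auto
    finally show ?thesis .
  qed
  moreover have "(\<lambda>n. emeasure std_normal_distribution {- real (Suc n)..real (Suc n)})
      \<longlonglongrightarrow> emeasure std_normal_distribution (\<Union>n. {- real (Suc n)..real (Suc n)})"
    by (intro Lim_emeasure_incseq) (auto simp: incseq_def)
  moreover have "(\<Union>n. {- real (Suc n)..real (Suc n)}) = UNIV"
  proof (intro equalityI subsetI UNIV_I)
    fix x :: real
    obtain n where "\<bar>x\<bar> \<le> real n" using real_arch_simple by blast
    then have "x \<in> {- real (Suc n)..real (Suc n)}" by auto
    then show "x \<in> (\<Union>n. {- real (Suc n)..real (Suc n)})" by blast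
  qed
  moreover have "emeasure std_normal_distribution UNIV = 1"
    using emeasure_space_1 by simp
  ultimately show ?thesis by simp
qed

text \<open>Gaussians that concentrate at 0 transversally to \<open>span B\<close> recover the volume of the section. To have
every nearby point in the box, the box is first dilated by a factor \<open>s > 1\<close>, which tends to 1 in
the end.\<close>

lemma box_section_le_sinc_integrals:
  fixes B C :: "(real^'n::{finite,wellorder}) set"
  assumes D: "orthonormal_basis_of UNIV (B \<union> C)" and dis: "B \<inter> C = {}"
    and a: "\<And>e. e \<in> Basis \<Longrightarrow> 0 < a \<bullet> e"
    and r: "\<And>e. e \<in> Basis \<Longrightarrow> r e = (norm (proj_span C e))\<^sup>2"
    and r1: "\<And>e. e \<in> Basis \<Longrightarrow> r e < 1"
  shows "emeasure (lborel_onb B) (cbox (-a) a)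
    \<le> ennreal ((\<Prod>e\<in>Basis. 2 * (a \<bullet> e)) / (2 * pi) ^ card C *
        (\<Prod>e | e \<in> Basis \<and> r e \<noteq> 0. (sinc_integral (1 / r e) / ((a \<bullet> e) * sqrt (r e))) powr r e))"
proof -
  have fin: "finite B" "finite C" using orthonormal_basis_of_finite[OF D] by auto
  have nC: "norm d = 1" if "d \<in> C" for d using D that by (auto simp: orthonormal_basis_of_def)
  define R where "R s = (\<Prod>e\<in>Basis. 2 * ((s *\<^sub>R a) \<bullet> e)) / (2 * pi) ^ card C *
        (\<Prod>e | e \<in> Basis \<and> r e \<noteq> 0. (sinc_integral (1 / r e) / (((s *\<^sub>R a) \<bullet> e) * sqrt (r e))) powr r e)" for s
  let ?V = "emeasure (lborel_onb B) (cbox (-a) a)"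
  have main: "?V \<le> ennreal (R s)" if s: "1 < s" for s
  proof -
    have sa: "0 < (s *\<^sub>R a) \<bullet> e" if "e \<in> Basis" for e using a[OF that] s by simp
    \<comment> \<open>A point at distance at most \<open>(s - 1) m\<close> from the section of the box still lies in the box dilated by \<open>s\<close>;
      \<open>\<eta>\<close> bounds each of the \<open>card C\<close> transversal coordinates accordingly (the \<open>+ 1\<close> covers \<open>C = {}\<close>).\<close>
    define m where "m = Min ((\<lambda>e. a \<bullet> e) ` Basis)"
    have m: "0 < m" "\<And>e. e \<in> Basis \<Longrightarrow> m \<le> a \<bullet> e"
      unfolding m_def using a by (auto simp: Min_gr_iff)
    define \<eta> where "\<eta> = (s - 1) * m / (card C + 1)"
    have \<eta>: "0 < \<eta>" unfolding \<eta>_def using s m by simp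
    have C\<eta>: "card C * \<eta> \<le> (s - 1) * m"
      unfolding \<eta>_def using s m by (simp add: divide_simps)
    define M where "M n = (\<integral>\<^sup>+t. ennreal (indicator {-\<eta>..\<eta>} t * normal_density 0 (\<eta> / Suc n) t) \<partial>lborel)" for n
    have dom: "x \<in> cbox (- (s *\<^sub>R a)) (s *\<^sub>R a)"
      if x: "proj_span B x \<in> cbox (-a) a" "\<And>d. d \<in> C \<Longrightarrow> \<bar>d \<bullet> x\<bar> \<le> \<eta>" for x
    proof -
      have dec: "x = proj_span B x + proj_span C x"
      proof -
        have "y \<bullet> x = y \<bullet> (proj_span B x + proj_span C x)" for y
        proof -
          have f: "(\<Sum>b\<in>B \<union> C. (b \<bullet> z)\<^sup>2) = z \<bullet> z" for z by (rule orthonormal_basis_Parseval[OF D])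
          have "(\<Sum>b\<in>B \<union> C. (1 * (b \<bullet> x)) *\<^sub>R b) = x"
            by (rule tight_frame_expansion[where u="\<lambda>b. b"]) (simp add: f)
          then have "proj_span B x + proj_span C x = x"
            unfolding proj_span_def using fin dis by (simp add: sum.union_disjoint)
          then show ?thesis by simp
        qed
        then show ?thesis by (metis vector_eq_ldot)
      qed
      have small: "norm (proj_span C x) \<le> (s - 1) * m"
      proof -
        have "norm (proj_span C x) \<le> (\<Sum>d\<in>C. norm ((d \<bullet> x) *\<^sub>R d))"
          unfolding proj_span_def by (rule norm_sum)
        also have "\<dots> \<le> (\<Sum>d\<in>C. \<eta>)" using x(2) nC by (intro sum_mono) simp
        finally show ?thesis using C\<eta> by simp
      qed
      have "- (s * (a \<bullet> e)) \<le> x \<bullet> e \<and> x \<bullet> e \<le> s * (a \<bullet> e)" if e: "e \<in> Basis" for e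
      proof -
        have "\<bar>proj_span C x \<bullet> e\<bar> \<le> (s - 1) * m"
          using Cauchy_Schwarz_ineq2[of "proj_span C x" e] small e by simp
        also have "\<dots> \<le> (s - 1) * (a \<bullet> e)" using m(2)[OF e] s by simp
        finally have "\<bar>proj_span C x \<bullet> e\<bar> \<le> (s - 1) * (a \<bullet> e)" .
        moreover have "\<bar>proj_span B x \<bullet> e\<bar> \<le> a \<bullet> e" using x(1) e by (auto simp: mem_box abs_le_iff)
        moreover have "x \<bullet> e = proj_span B x \<bullet> e + proj_span C x \<bullet> e"
          by (subst dec) (simp add: inner_add_left)
        moreover have "(s - 1) * (a \<bullet> e) = s * (a \<bullet> e) - a \<bullet> e" by (simp add: algebra_simps)
        ultimately show ?thesis by linarith
      qed
      then show ?thesis by (simp add: mem_box)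
    qed
    have "?V * M n ^ card C \<le> ennreal (R s)" for n
    proof -
      let ?\<sigma> = "\<eta> / Suc n"
      let ?h = "\<lambda>t. ennreal (indicator {-\<eta>..\<eta>} t * normal_density 0 ?\<sigma> t)"
      have "?V * M n ^ card C = (\<integral>\<^sup>+x. indicator (cbox (-a) a) (proj_span B x) * (\<Prod>d\<in>C. ?h (d \<bullet> x)) \<partial>lborel)"
        unfolding M_def by (subst emeasure_lborel_onb_mult_slab[OF D dis]) auto
      also have "\<dots> \<le> (\<integral>\<^sup>+x. ennreal (indicator (cbox (- (s *\<^sub>R a)) (s *\<^sub>R a)) x * (\<Prod>d\<in>C. normal_density 0 ?\<sigma> (d \<bullet> x))) \<partial>lborel)"
      proof (rule nn_integral_mono)
        fix x :: "real^'n::_"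
        have pe: "(\<Prod>d\<in>C. ?h (d \<bullet> x)) = ennreal (\<Prod>d\<in>C. indicator {-\<eta>..\<eta>} (d \<bullet> x) * normal_density 0 ?\<sigma> (d \<bullet> x))"
          by (rule prod_ennreal) simp
        show "indicator (cbox (-a) a) (proj_span B x) * (\<Prod>d\<in>C. ?h (d \<bullet> x))
            \<le> ennreal (indicator (cbox (- (s *\<^sub>R a)) (s *\<^sub>R a)) x * (\<Prod>d\<in>C. normal_density 0 ?\<sigma> (d \<bullet> x)))"
        proof (cases "proj_span B x \<in> cbox (-a) a \<and> (\<forall>d\<in>C. \<bar>d \<bullet> x\<bar> \<le> \<eta>)")
          case True
          then have "x \<in> cbox (- (s *\<^sub>R a)) (s *\<^sub>R a)" using dom by blast
          moreover have "(\<Prod>d\<in>C. indicator {-\<eta>..\<eta>} (d \<bullet> x) * normal_density 0 ?\<sigma> (d \<bullet> x)) = (\<Prod>d\<in>C. normal_density 0 ?\<sigma> (d \<bullet> x))"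
            using True by (intro prod.cong) (auto simp: indicator_def abs_le_iff)
          ultimately show ?thesis unfolding pe using True by simp
        next
          case False
          then have "indicator (cbox (-a) a) (proj_span B x) * (\<Prod>d\<in>C. ?h (d \<bullet> x)) = 0"
          proof (cases "proj_span B x \<in> cbox (-a) a")
            case True
            then obtain d where d: "d \<in> C" "\<not> \<bar>d \<bullet> x\<bar> \<le> \<eta>" using False by blast
            then have "?h (d \<bullet> x) = 0" by (auto simp: indicator_def abs_le_iff)
            then have "(\<Prod>d\<in>C. ?h (d \<bullet> x)) = 0" using d fin by (intro prod_zero) auto
            then show ?thesis by simp
          qed simp
          then show ?thesis by (simp only: zero_le)
        qed
      qed
      also have "\<dots> \<le> ennreal ((\<Prod>e\<in>Basis. 2 * ((s *\<^sub>R a) \<bullet> e)) / (2 * pi) ^ card C) *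
          (\<integral>\<^sup>+y. ennreal ((\<Prod>b\<in>B. std_normal_density (b \<bullet> y)) *
            (\<Prod>e\<in>Basis. \<bar>sinc (((s *\<^sub>R a) \<bullet> e) * (e \<bullet> proj_span C y))\<bar>)) \<partial>lborel)"
        using sa \<eta> by (intro gaussian_slab_Fourier_bound[OF D dis]) (auto intro: less_imp_le)
      also have "\<dots> \<le> ennreal ((\<Prod>e\<in>Basis. 2 * ((s *\<^sub>R a) \<bullet> e)) / (2 * pi) ^ card C) *
          ennreal (\<Prod>e | e \<in> Basis \<and> r e \<noteq> 0. (sinc_integral (1 / r e) / (((s *\<^sub>R a) \<bullet> e) * sqrt (r e))) powr r e)"
        by (intro mult_left_mono sinc_product_bound[OF D dis sa r r1]) auto
      also have "\<dots> = ennreal (R s)"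
        unfolding R_def by (rule ennreal_mult[symmetric])
          (auto intro!: divide_nonneg_nonneg prod_nonneg mult_nonneg_nonneg less_imp_le[OF sa] simp del: inner_scaleR_left)
      finally show ?thesis .
    qed
    moreover have "(\<lambda>n. ?V * M n ^ k) \<longlonglongrightarrow> ?V" for k
    proof (induction k)
      case (Suc k)
      have "(\<lambda>n. ?V * M n ^ k * M n) \<longlonglongrightarrow> ?V * 1"
        using Suc std_normal_mass_limit[OF \<eta>] unfolding M_def by (rule tendsto_mult_ennreal) simp
      then show ?case by (simp add: mult_ac)
    qed simp
    ultimately show ?thesis
      by (intro LIMSEQ_le_const2[of "\<lambda>n. ?V * M n ^ card C"]) auto
  qed
  have "(\<lambda>n. ennreal (R (1 + inverse (real (Suc n))))) \<longlonglongrightarrow> ennreal (R (1 + 0))"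
  proof (rule tendsto_ennrealI, unfold R_def, intro tendsto_mult tendsto_divide tendsto_const tendsto_prod)
    fix e assume "e \<in> {e \<in> Basis. r e \<noteq> 0}"
    then have e: "0 < a \<bullet> e" "0 < r e" using r a by (auto simp: less_le)
    have "0 \<le> sinc_integral (1 / r e)" by (simp add: sinc_integral_def)
    then have "0 \<le> sinc_integral (1 / r e) / ((((1 + inverse (real (Suc n))) *\<^sub>R a) \<bullet> e) * sqrt (r e))" for n
      using e by simp
    moreover have "(\<lambda>n. sinc_integral (1 / r e) / ((((1 + inverse (real (Suc n))) *\<^sub>R a) \<bullet> e) * sqrt (r e)))
       \<longlonglongrightarrow> sinc_integral (1 / r e) / ((((1 + 0) *\<^sub>R a) \<bullet> e) * sqrt (r e))"
      using e by (intro tendsto_intros LIMSEQ_inverse_real_of_nat) auto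
    ultimately show "(\<lambda>n. (sinc_integral (1 / r e) / ((((1 + inverse (real (Suc n))) *\<^sub>R a) \<bullet> e) * sqrt (r e))) powr r e)
       \<longlonglongrightarrow> (sinc_integral (1 / r e) / ((((1 + 0) *\<^sub>R a) \<bullet> e) * sqrt (r e))) powr r e"
      using e by (intro tendsto_powr' tendsto_const) (auto intro!: always_eventually)
  next
    fix e :: "real^'n::_"
    show "(\<lambda>n. ((1 + inverse (real (Suc n))) *\<^sub>R a) \<bullet> e) \<longlonglongrightarrow> ((1 + 0) *\<^sub>R a) \<bullet> e"
      by (intro tendsto_intros LIMSEQ_inverse_real_of_nat)
  qed simp
  then have "?V \<le> ennreal (R (1 + 0))"
    by (rule tendsto_lowerbound) (auto intro!: always_eventually main)
  then show ?thesis by (simp add: R_def)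
qed

text \<open>The contribution of a coordinate with half-width \<open>a\<close> whose unit vector has squared norm \<open>t\<close> after
projection to the subspace. For \<open>t = 1\<close> the coordinate direction lies in the subspace, no sinc integral
occurs, and only the half-width remains.\<close>

definition slice_factor :: "real \<Rightarrow> real \<Rightarrow> real" where
  "slice_factor a t = (if t = 1 then a
     else (sinc_integral (1 / (1 - t)) / (pi * sqrt (1 - t))) powr (1 - t) * a powr t)"

text \<open>Distributes the constants of \<open>box_section_le_sinc_integrals\<close> over the coordinates. The factors \<open>2 powr (1 - r)\<close>
multiply to \<open>2 ^ k\<close> because the dimension \<open>k\<close> of the subspace is the sum of the \<open>1 - r\<close>.\<close>

lemma slice_factor_eq:
  assumes a: "0 < a" and r: "0 \<le> r"
  shows "2 * a / (2 * pi) powr r * (if r = 0 then 1 else (sinc_integral (1 / r) / (a * sqrt r)) powr r)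
    = 2 powr (1 - r) * slice_factor a (1 - r)"
proof (cases "r = 0")
  case False
  have I: "0 \<le> sinc_integral (1 / r)" by (simp add: sinc_integral_def)
  show ?thesis
    using False a r I
    by (simp add: slice_factor_def powr_divide powr_mult powr_diff field_simps)
qed (simp add: slice_factor_def)

lemma box_section_le_slice_factors:
  fixes B C :: "(real^'n::{finite,wellorder}) set"
  assumes D: "orthonormal_basis_of UNIV (B \<union> C)" and dis: "B \<inter> C = {}"
    and a: "\<And>e. e \<in> Basis \<Longrightarrow> 0 < a \<bullet> e"
    and pos: "\<And>e. e \<in> Basis \<Longrightarrow> 0 < (\<Sum>b\<in>B. (b \<bullet> e)\<^sup>2)"
  shows "emeasure (lborel_onb B) (cbox (-a) a)
    \<le> ennreal (2 ^ card B * (\<Prod>e\<in>Basis. slice_factor (a \<bullet> e) (\<Sum>b\<in>B. (b \<bullet> e)\<^sup>2)))"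
proof -
  have fin: "finite B" "finite C" using orthonormal_basis_of_finite[OF D] by auto
  have onC: "pairwise orthogonal C" "\<forall>b\<in>C. norm b = 1"
    using D by (auto simp: orthonormal_basis_of_def intro: pairwise_subset)
  define r where "r e = (norm (proj_span C e))\<^sup>2" for e
  have r_sum: "r e = (\<Sum>d\<in>C. (d \<bullet> e)\<^sup>2)" for e
    unfolding r_def by (rule norm_proj_span_sq[OF fin(2) onC])
  have r_eq: "(\<Sum>b\<in>B. (b \<bullet> e)\<^sup>2) = 1 - r e" if "e \<in> Basis" for e
  proof -
    have "(\<Sum>b\<in>B. (b \<bullet> e)\<^sup>2) + (\<Sum>d\<in>C. (d \<bullet> e)\<^sup>2) = (\<Sum>b\<in>B \<union> C. (b \<bullet> e)\<^sup>2)"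
      using fin dis by (simp add: sum.union_disjoint)
    also have "\<dots> = 1" using orthonormal_basis_Parseval[OF D, of e] that by simp
    finally show ?thesis by (simp add: r_sum)
  qed
  have r0: "0 \<le> r e" for e by (simp add: r_def)
  have cC: "real (card C) = (\<Sum>e\<in>Basis. r e)"
  proof -
    have "(\<Sum>e\<in>Basis. r e) = (\<Sum>d\<in>C. \<Sum>e\<in>Basis. (e \<bullet> d)\<^sup>2)"
      unfolding r_sum by (subst sum.swap) (simp add: inner_commute)
    also have "\<dots> = (\<Sum>d\<in>C. d \<bullet> d)"
      by (simp only: orthonormal_basis_Parseval[OF orthonormal_basis_of_Basis])
    also have "\<dots> = card C" using onC by (simp add: norm_eq_1)
    finally show ?thesis by simp
  qed
  have cB: "real (card B) = (\<Sum>e\<in>(Basis :: (real^'n::_) set). 1 - r e)"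
  proof -
    have "card B + card C = card (Basis :: (real^'n::_) set)"
      using orthonormal_basis_of_finite(2)[OF D] fin dis by (simp add: card_Un_disjoint)
    then have "real (card B) = real (card (Basis :: (real^'n::_) set)) - real (card C)" by linarith
    then show ?thesis by (simp add: cC sum_subtractf)
  qed
  have "emeasure (lborel_onb B) (cbox (-a) a)
    \<le> ennreal ((\<Prod>e\<in>Basis. 2 * (a \<bullet> e)) / (2 * pi) ^ card C *
        (\<Prod>e | e \<in> Basis \<and> r e \<noteq> 0. (sinc_integral (1 / r e) / ((a \<bullet> e) * sqrt (r e))) powr r e))"
  proof (rule box_section_le_sinc_integrals[OF D dis a])
    fix e :: "real^'n::_" assume e: "e \<in> Basis"
    show "r e < 1" using r_eq[OF e] pos[OF e] by simp
  qed (auto simp: r_def)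
  also have "(\<Prod>e\<in>Basis. 2 * (a \<bullet> e)) / (2 * pi) ^ card C *
        (\<Prod>e | e \<in> Basis \<and> r e \<noteq> 0. (sinc_integral (1 / r e) / ((a \<bullet> e) * sqrt (r e))) powr r e)
      = (\<Prod>e\<in>Basis. 2 * (a \<bullet> e) / (2 * pi) powr r e *
          (if r e = 0 then 1 else (sinc_integral (1 / r e) / ((a \<bullet> e) * sqrt (r e))) powr r e))"
  proof -
    have "(2 * pi) ^ card C = (\<Prod>e\<in>(Basis :: (real^'n::_) set). (2 * pi) powr r e)"
    proof -
      have "(2 * pi) ^ card C = (2 * pi) powr real (card C)" by (rule powr_realpow[symmetric]) simp
      also have "\<dots> = (\<Prod>e\<in>(Basis :: (real^'n::_) set). (2 * pi) powr r e)"
        unfolding cC by (rule powr_sum) auto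
      finally show ?thesis .
    qed
    moreover have "(\<Prod>e | e \<in> Basis \<and> r e \<noteq> 0. (sinc_integral (1 / r e) / ((a \<bullet> e) * sqrt (r e))) powr r e)
        = (\<Prod>e\<in>Basis. if r e = 0 then 1 else (sinc_integral (1 / r e) / ((a \<bullet> e) * sqrt (r e))) powr r e)"
      by (rule prod.mono_neutral_cong_left) auto
    ultimately show ?thesis by (simp only: prod.distrib prod_dividef)
  qed
  also have "\<dots> = (\<Prod>e\<in>Basis. 2 powr (1 - r e) * slice_factor (a \<bullet> e) (1 - r e))"
    by (intro prod.cong refl slice_factor_eq a r0)
  also have "\<dots> = (\<Prod>e\<in>(Basis :: (real^'n::_) set). 2 powr (1 - r e)) * (\<Prod>e\<in>Basis. slice_factor (a \<bullet> e) (\<Sum>b\<in>B. (b \<bullet> e)\<^sup>2))"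
    using r_eq by (simp add: prod.distrib)
  also have "(\<Prod>e\<in>(Basis :: (real^'n::_) set). 2 powr (1 - r e)) = 2 ^ card B"
  proof -
    have "(2::real) ^ card B = 2 powr real (card B)" by (rule powr_realpow[symmetric]) simp
    also have "\<dots> = (\<Prod>e\<in>(Basis :: (real^'n::_) set). 2 powr (1 - r e))"
      unfolding cB by (rule powr_sum) auto
    finally show ?thesis ..
  qed
  finally show ?thesis .
qed

section \<open>Arbitrary dimension\<close>

text \<open>The bound for sections of boxes in \<open>\<real>\<^sup>N\<close>, expressed without reference to a type of dimension \<open>N\<close>: the
rows \<open>b 0, \<dots>, b (k - 1)\<close> are an orthonormal basis of the subspace.\<close>

definition slice_bound :: "nat \<Rightarrow> bool" where
  "slice_bound N \<longleftrightarrow> (\<forall>(k::nat) (b :: nat \<Rightarrow> nat \<Rightarrow> real) (a :: nat \<Rightarrow> real).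
     (\<forall>i<k. \<forall>i'<k. (\<Sum>j<N. b i j * b i' j) = (if i = i' then 1 else 0)) \<longrightarrow>
     (\<forall>j<N. 0 < a j \<and> 0 < (\<Sum>i<k. (b i j)\<^sup>2)) \<longrightarrow>
     emeasure (\<Pi>\<^sub>M i\<in>{..<k}. (lborel :: real measure))
         {f \<in> space (\<Pi>\<^sub>M i\<in>{..<k}. (lborel :: real measure)). \<forall>j<N. \<bar>\<Sum>i<k. f i * b i j\<bar> \<le> a j}
       \<le> ennreal (2 ^ k * (\<Prod>j<N. slice_factor (a j) (\<Sum>i<k. (b i j)\<^sup>2))))"

lemma slice_bound_card_of_index_type: "slice_bound CARD('n::{finite,wellorder})"
  unfolding slice_bound_def
proof (intro allI impI)
  fix k :: nat and b :: "nat \<Rightarrow> nat \<Rightarrow> real" and a :: "nat \<Rightarrow> real"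
  let ?N = "CARD('n)"
  assume on: "\<forall>i<k. \<forall>i'<k. (\<Sum>j<?N. b i j * b i' j) = (if i = i' then 1 else 0)"
    and pos: "\<forall>j<?N. 0 < a j \<and> 0 < (\<Sum>i<k. (b i j)\<^sup>2)"
  obtain \<iota> where \<iota>: "bij_betw \<iota> (UNIV :: 'n set) {..<?N}"
    using finite_same_card_bij[of "UNIV :: 'n set" "{..<?N}"] by auto
  have \<iota>N: "\<iota> j < ?N" for j using \<iota> by (auto simp: bij_betw_def)
  define \<beta> :: "nat \<Rightarrow> real^'n::_" where "\<beta> i = (\<chi> j. b i (\<iota> j))" for i
  define \<alpha> :: "real^'n::_" where "\<alpha> = (\<chi> j. a (\<iota> j))"
  have inner: "\<beta> i \<bullet> \<beta> i' = (if i = i' then 1 else 0)" if "i < k" "i' < k" for i i'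
    using on that sum.reindex_bij_betw[OF \<iota>, of "\<lambda>j. b i j * b i' j"]
    by (simp add: \<beta>_def inner_vec_def)
  have inj: "inj_on \<beta> {..<k}"
    by (intro inj_onI) (metis inner lessThan_iff zero_neq_one)
  let ?B = "\<beta> ` {..<k}"
  have onB: "pairwise orthogonal ?B" "\<forall>b\<in>?B. norm b = 1"
    using inner by (auto simp: pairwise_def orthogonal_def norm_eq_1)
  obtain C where C: "orthonormal_basis_of UNIV (?B \<union> C)" "?B \<inter> C = {}"
    using orthonormal_basis_of_complement[OF onB] by blast
  have ax: "x \<bullet> axis j 1 = x $ j" for x :: "real^'n::_" and j by (simp add: inner_axis)
  have Basis: "(Basis :: (real^'n::_) set) = range (\<lambda>j. axis j 1)" by (auto simp: Basis_vec_def)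
  have t: "(\<Sum>d\<in>?B. (d \<bullet> axis j 1)\<^sup>2) = (\<Sum>i<k. (b i (\<iota> j))\<^sup>2)" for j
    unfolding ax sum.reindex[OF inj] by (simp add: \<beta>_def)
  let ?P = "\<Pi>\<^sub>M i\<in>{..<k}. (lborel :: real measure)"
  let ?S = "{f \<in> space ?P. \<forall>j<?N. \<bar>\<Sum>i<k. f i * b i j\<bar> \<le> a j}"
  have mem: "(\<Sum>i<k. f i *\<^sub>R \<beta> i) \<in> cbox (-\<alpha>) \<alpha> \<longleftrightarrow> (\<forall>j<?N. \<bar>\<Sum>i<k. f i * b i j\<bar> \<le> a j)" for f
  proof -
    have "(\<Sum>i<k. f i *\<^sub>R \<beta> i) \<in> cbox (-\<alpha>) \<alpha> \<longleftrightarrow> (\<forall>j. \<bar>\<Sum>i<k. f i * b i (\<iota> j)\<bar> \<le> a (\<iota> j))"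
      by (simp add: mem_box_cart \<alpha>_def \<beta>_def abs_le_iff minus_le_iff conj_commute)
    also have "\<dots> \<longleftrightarrow> (\<forall>j\<in>\<iota> ` UNIV. \<bar>\<Sum>i<k. f i * b i j\<bar> \<le> a j)" by auto
    also have "\<iota> ` UNIV = {..<?N}" using \<iota> by (simp add: bij_betw_def)
    finally show ?thesis by auto
  qed
  have sm: "(\<lambda>f. \<Sum>i<k. f i *\<^sub>R \<beta> i) \<in> measurable ?P borel" by measurable
  have "emeasure ?P ?S = emeasure ?P ((\<lambda>f. \<Sum>i<k. f i *\<^sub>R \<beta> i) -` cbox (-\<alpha>) \<alpha> \<inter> space ?P)"
    by (rule arg_cong[where f="emeasure ?P"]) (auto simp: mem)
  also have "\<dots> = emeasure (lborel_onb ?B) (cbox (-\<alpha>) \<alpha>)"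
    unfolding lborel_onb_indexed[OF finite_lessThan inj] by (intro emeasure_distr[symmetric] sm) auto
  also have "\<dots> \<le> ennreal (2 ^ card ?B * (\<Prod>e\<in>Basis. slice_factor (\<alpha> \<bullet> e) (\<Sum>d\<in>?B. (d \<bullet> e)\<^sup>2)))"
  proof (rule box_section_le_slice_factors[OF C])
    fix e :: "real^'n::_" assume "e \<in> Basis"
    then obtain j where e: "e = axis j 1" using Basis by auto
    show "0 < \<alpha> \<bullet> e" "0 < (\<Sum>d\<in>?B. (d \<bullet> e)\<^sup>2)"
      unfolding e t unfolding ax using pos \<iota>N[of j] by (auto simp: \<alpha>_def)
  qed
  also have "card ?B = k" using inj by (simp add: card_image)
  also have "(\<Prod>e\<in>Basis. slice_factor (\<alpha> \<bullet> e) (\<Sum>d\<in>?B. (d \<bullet> e)\<^sup>2))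
      = (\<Prod>j\<in>UNIV. slice_factor (a (\<iota> j)) (\<Sum>i<k. (b i (\<iota> j))\<^sup>2))"
  proof -
    have "inj (\<lambda>j::'n. axis j (1::real))" by (auto intro!: injI simp: axis_eq_axis)
    then show ?thesis unfolding Basis by (simp only: prod.reindex o_def t) (simp add: ax \<alpha>_def)
  qed
  also have "\<dots> = (\<Prod>j<?N. slice_factor (a j) (\<Sum>i<k. (b i j)\<^sup>2))"
    by (rule prod.reindex_bij_betw[OF \<iota>])
  finally show "emeasure ?P ?S \<le> ennreal (2 ^ k * (\<Prod>j<?N. slice_factor (a j) (\<Sum>i<k. (b i j)\<^sup>2)))" .
qed

definition critical_dim :: nat where
  "critical_dim = (SOME N. 0 < N \<and> \<not> slice_bound N)"

text \<open>A type cannot depend on a variable \<open>N\<close>, but it may depend on the constant \<open>critical_dim\<close>, which is a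
counterexample to \<open>slice_bound\<close> if there is one at all. Since \<open>slice_bound\<close> holds for the cardinality of this
type, \<open>critical_dim\<close> is no counterexample and hence there is none. The element 0 keeps the type inhabited if
\<open>critical_dim\<close> happens to be 0.\<close>

typedef coord = "{i. i < critical_dim \<or> i = 0}" by auto

text \<open>The change of variables theorem for \<open>real ^ 'n\<close> asks for a well-ordered index type.\<close>

instantiation coord :: wellorder
begin

definition "x \<le> y \<longleftrightarrow> Rep_coord x \<le> Rep_coord y"
definition "x < y \<longleftrightarrow> Rep_coord x < Rep_coord y"

instance
proof
  fix P :: "coord \<Rightarrow> bool" and x
  assume step: "\<And>x. (\<And>y. y < x \<Longrightarrow> P y) \<Longrightarrow> P x"
  show "P x"
  proof (induction "Rep_coord x" arbitrary: x rule: less_induct)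
    case less
    show ?case by (rule step, rule less) (simp add: less_coord_def)
  qed
qed (auto simp: less_eq_coord_def less_coord_def Rep_coord_inject)

end

lemma UNIV_coord: "(UNIV :: coord set) = Abs_coord ` {i. i < critical_dim \<or> i = 0}"
  using type_definition.Abs_image[OF type_definition_coord] by simp

instance coord :: finite
proof
  have "{i. i < critical_dim \<or> i = 0} = insert 0 {..<critical_dim}" by auto
  then show "finite (UNIV :: coord set)" unfolding UNIV_coord by simp
qed

text \<open>Dimension 0 is treated apart because types are not empty.\<close>

lemma slice_bound_every_dim: "slice_bound N"
proof (cases "N = 0")
  case True
  show ?thesis
    unfolding slice_bound_def True
  proof (intro allI impI)
    fix k :: nat and b :: "nat \<Rightarrow> nat \<Rightarrow> real" and a :: "nat \<Rightarrow> real"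
    assume "\<forall>i<k. \<forall>i'<k. (\<Sum>j<0. b i j * b i' j) = (if i = i' then 1 else 0)"
    then have "k = 0" by (metis lessThan_0 sum.empty zero_neq_one neq0_conv)
    then show "emeasure (\<Pi>\<^sub>M i\<in>{..<k}. (lborel :: real measure))
         {f \<in> space (\<Pi>\<^sub>M i\<in>{..<k}. (lborel :: real measure)). \<forall>j<0. \<bar>\<Sum>i<k. f i * b i j\<bar> \<le> a j}
       \<le> ennreal (2 ^ k * (\<Prod>j<0. slice_factor (a j) (\<Sum>i<k. (b i j)\<^sup>2)))"
      by (simp add: PiM_empty)
  qed
next
  case False
  show ?thesis
  proof (rule ccontr)
    assume "\<not> slice_bound N"
    then have ex: "0 < N \<and> \<not> slice_bound N" using False by simp
    have crit: "0 < critical_dim \<and> \<not> slice_bound critical_dim"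
      unfolding critical_dim_def by (rule someI[of _ N]) (rule ex)
    then have "{i. i < critical_dim \<or> i = 0} = {..<critical_dim}" by auto
    then have "CARD(coord) = critical_dim"
      using type_definition.card[OF type_definition_coord] by simp
    then show False using slice_bound_card_of_index_type[where 'n=coord] crit by simp
  qed
qed

section \<open>Bodies in John's position\<close>

text \<open>A hyperplane supporting \<open>K\<close> at \<open>v\<close> also supports the ball at \<open>v\<close> and is therefore orthogonal to \<open>v\<close>.\<close>

lemma contact_point_slab:
  fixes K :: "'a::euclidean_space set"
  assumes K: "convex K" "compact K" and B: "cball 0 1 \<subseteq> K"
    and v: "v \<in> frontier K" "norm v = 1" and x: "x \<in> K"
  shows "v \<bullet> x \<le> 1"
proof -
  obtain w where w: "w \<noteq> 0" "\<And>y. y \<in> closure K \<Longrightarrow> w \<bullet> v \<le> w \<bullet> y"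
  proof (rule supporting_hyperplane_relative_frontier[OF K(1)])
    show "v \<in> closure K" using v(1) by (simp add: frontier_def)
    have "0 \<in> interior K" using interior_mono[OF B] by auto
    then have "rel_interior K = interior K" by (intro rel_interior_nonempty_interior) auto
    then show "v \<notin> rel_interior K" using v(1) by (simp add: frontier_def)
  qed blast
  have cl: "closure K = K" using K(2) by (simp add: compact_imp_closed)
  \<comment> \<open>The supporting functional \<open>w\<close> is tested at the point of the unit ball where it is smallest; this forces
    \<open>w\<close> to be a negative multiple of \<open>v\<close>.\<close>
  have "- (w /\<^sub>R norm w) \<in> K" using B w(1) by (auto simp: subset_iff)
  then have "w \<bullet> v \<le> w \<bullet> (- (w /\<^sub>R norm w))" using w(2) cl by blast
  also have "\<dots> = - norm w" using w(1) by (simp add: power2_norm_eq_inner[symmetric] power2_eq_square)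
  finally have le: "w \<bullet> v \<le> - norm w" .
  have "(norm (w + norm w *\<^sub>R v))\<^sup>2 = 2 * (norm w)\<^sup>2 + 2 * norm w * (w \<bullet> v)"
    using v(2) by (simp add: power2_norm_eq_inner inner_add_left inner_add_right inner_commute norm_eq_1)
      (simp add: power2_norm_eq_inner[symmetric] power2_eq_square)
  also have "\<dots> \<le> 0"
  proof -
    have "norm w * (w \<bullet> v) \<le> norm w * (- norm w)" using le by (intro mult_left_mono) auto
    then show ?thesis by (simp add: power2_eq_square)
  qed
  finally have "w = - (norm w *\<^sub>R v)" by (simp add: eq_neg_iff_add_eq_0)
  then have "w \<bullet> y = - norm w * (v \<bullet> y)" for y by (metis inner_minus_left inner_scaleR_left mult_minus_left)
  then have "- norm w * (v \<bullet> v) \<le> - norm w * (v \<bullet> x)" using w(2)[of x] x cl by simp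
  then show ?thesis using w(1) v(2) by (simp add: norm_eq_1)
qed

lemma cube_vol_eq: "cube_vol k = 2 ^ k"
proof -
  have "emeasure (\<Pi>\<^sub>M i\<in>{..<k}. (lborel :: real measure)) (cube k) = 2 ^ k"
    unfolding cube_def by (subst lb.emeasure_PiM) auto
  then show ?thesis by (simp add: cube_vol_def measure_def flip: ennreal_numeral ennreal_power)
qed

lemma orth_proj_eq_proj_span:
  assumes H: "subspace H" and B: "orthonormal_basis_of H B"
  shows "orth_proj H x = proj_span B x"
proof (rule orth_proj_unique[OF H])
  have BH: "B \<subseteq> H" "span B = H" using B by (auto simp: orthonormal_basis_of_def)
  show "proj_span B x \<in> H"
    unfolding proj_span_def using BH H by (intro subspace_sum subspace_scale) auto
  have "orthogonal (x - proj_span B x) b" if "b \<in> B" for b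
    using coordinate_of_sum[OF B that, of "\<lambda>b. b \<bullet> x"]
    by (simp add: orthogonal_def proj_span_def inner_diff_right inner_commute[of _ b])
  then have "orthogonal (x - proj_span B x) y" if "y \<in> span B" for y
    using that orthogonal_to_span by blast
  then show "x - proj_span B x \<in> H\<^sup>\<bottom>"
    using BH by (auto simp: orthogonal_comp_def orthogonal_commute)
qed

theorem theorem9:
  fixes K H :: "(real ^ 'n) set" and m k :: nat
    and c :: "nat \<Rightarrow> real" and v :: "nat \<Rightarrow> real ^ 'n"
    and J :: "nat set" and ct :: "nat \<Rightarrow> real"
  assumes "convex_body K" and "centrally_symmetric K" and "john_position K"
    and "decomposition_of_identity K m c v"
    and "subspace H" and "dim H = k"
    and "J = {j \<in> {1..m}. orth_proj H (v j) \<noteq> 0}"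
    and "\<forall>j\<in>J. ct j = c j * (norm (orth_proj H (v j)))\<^sup>2"
  shows "(\<forall>j\<in>J. ct j = 1 \<longrightarrow> c j = 1 \<and> norm (orth_proj H (v j)) = 1) \<and>
    subspace_vol H (K \<inter> H) \<le> cube_vol k *
      (\<Prod>j\<in>J. if ct j = 1 then 1
         else (sinc_integral (1 / (1 - ct j)) / (pi * sqrt (1 - ct j))) powr (1 - ct j)
              * c j powr (ct j / 2))"
proof -
  have K: "convex K" "compact K" "uminus ` K = K" "cball 0 1 \<subseteq> K"
    using assms(1-3)
    by (auto simp: convex_body_def centrally_symmetric_def john_position_def max_volume_ellipsoid_def)
  have cv: "0 < c j" "c j \<le> 1" "v j \<in> frontier K" "norm (v j) = 1" if "j \<in> {1..m}" for j
    using assms(4) that by (auto simp: decomposition_of_identity_def)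
  have ident: "x = (\<Sum>j=1..m. c j *\<^sub>R (v j \<bullet> x) *\<^sub>R v j)" for x
    using assms(4) unfolding decomposition_of_identity_def tensor_square_def by (metis id_apply)
  have JI: "J \<subseteq> {1..m}" and finJ: "finite J" using assms(7) by auto
  obtain B where B: "orthonormal_basis_of H B" using orthonormal_basis_of_exists[OF assms(5)] by blast
  have fB: "finite B" "card B = k" using orthonormal_basis_of_finite[OF B] assms(6) by auto
  have onB: "pairwise orthogonal B" "\<forall>b\<in>B. norm b = 1" and BH: "B \<subseteq> H"
    using B by (auto simp: orthonormal_basis_of_def)
  have P: "orth_proj H x = proj_span B x" for x by (rule orth_proj_eq_proj_span[OF assms(5) B])
  have nP: "(norm (orth_proj H x))\<^sup>2 = (\<Sum>b\<in>B. (b \<bullet> x)\<^sup>2)" for x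
    unfolding P by (rule norm_proj_span_sq[OF fB(1) onB])
  have nP1: "(norm (orth_proj H (v j)))\<^sup>2 \<le> 1" if "j \<in> {1..m}" for j
  proof -
    have "(norm (orth_proj H (v j)))\<^sup>2 = v j \<bullet> orth_proj H (v j)"
      unfolding P power2_norm_eq_inner proj_span_orthonormal[OF fB(1) onB] ..
    also have "\<dots> \<le> norm (orth_proj H (v j))"
      using Cauchy_Schwarz_ineq2[of "v j" "orth_proj H (v j)"] cv(4)[OF that] by simp
    finally have "(norm (orth_proj H (v j)))\<^sup>2 \<le> norm (orth_proj H (v j))" .
    note le = this
    have "norm (orth_proj H (v j)) \<le> 1"
    proof (rule ccontr)
      let ?p = "norm (orth_proj H (v j))"
      assume "\<not> ?p \<le> 1"
      then have "?p * 1 < ?p * ?p" by (intro mult_strict_left_mono) auto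
      with le show False by (simp add: power2_eq_square)
    qed
    then show ?thesis by (simp add: power_le_one)
  qed
  have bv0: "b \<bullet> v j = 0" if "b \<in> B" "j \<in> {1..m} - J" for b j
  proof -
    have "(\<Sum>b\<in>B. (b \<bullet> v j)\<^sup>2) = 0" using that assms(7) nP[of "v j"] by auto
    then show ?thesis using that fB(1) by (simp add: sum_nonneg_eq_0_iff)
  qed
  have first: "c j = 1 \<and> norm (orth_proj H (v j)) = 1" if j: "j \<in> J" and one: "ct j = 1" for j
  proof -
    have m: "j \<in> {1..m}" using j JI by auto
    let ?p = "(norm (orth_proj H (v j)))\<^sup>2"
    have e: "c j * ?p = 1" using assms(8) j one by simp
    have "c j * ?p \<le> c j * 1" "c j * ?p \<le> 1 * ?p"
      using cv(1,2)[OF m] nP1[OF m] mult_left_mono[of ?p 1 "c j"] mult_right_mono[of "c j" 1 ?p] by auto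
    then have "c j = 1" "?p = 1" using e cv(2)[OF m] nP1[OF m] by auto
    then show ?thesis using norm_ge_zero[of "orth_proj H (v j)"] by (auto simp: power2_eq_1_iff)
  qed
  \<comment> \<open>The vectors \<open>sqrt (c j) P v\<^sub>j\<close> form a Parseval frame of \<open>H\<close>. Their coordinates in an orthonormal basis
    of \<open>H\<close> are the entries of a matrix with orthonormal rows, and \<open>ct j\<close> are its squared column norms.\<close>
  define N where "N = card J"
  obtain \<iota> where \<iota>: "bij_betw \<iota> {..<N} J"
    using finJ unfolding N_def by (metis card_lessThan finite_lessThan finite_same_card_bij)
  obtain \<beta> where \<beta>: "bij_betw \<beta> {..<k} B"
    using fB by (metis card_lessThan finite_lessThan finite_same_card_bij)
  have \<iota>J: "\<iota> l \<in> J" if "l < N" for l using \<iota> that by (auto simp: bij_betw_def)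
  have \<beta>B: "\<beta> i \<in> B" if "i < k" for i using \<beta> that by (auto simp: bij_betw_def)
  have inj: "inj_on \<beta> {..<k}" and im: "\<beta> ` {..<k} = B" using \<beta> by (auto simp: bij_betw_def)
  define b where "b i l = sqrt (c (\<iota> l)) * (\<beta> i \<bullet> v (\<iota> l))" for i l
  define a where "a l = sqrt (c (\<iota> l))" for l
  have cpos: "0 < c (\<iota> l)" if "l < N" for l using \<iota>J[OF that] JI cv(1) by auto
  have on: "(\<Sum>l<N. b i l * b i' l) = (if i = i' then 1 else 0)" if i: "i < k" "i' < k" for i i'
  proof -
    have "(\<Sum>l<N. b i l * b i' l) = (\<Sum>l<N. c (\<iota> l) * (\<beta> i \<bullet> v (\<iota> l)) * (\<beta> i' \<bullet> v (\<iota> l)))"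
    proof (rule sum.cong)
      fix l assume "l \<in> {..<N}"
      then have "sqrt (c (\<iota> l)) * sqrt (c (\<iota> l)) = c (\<iota> l)" using cpos[of l] by simp
      then show "b i l * b i' l = c (\<iota> l) * (\<beta> i \<bullet> v (\<iota> l)) * (\<beta> i' \<bullet> v (\<iota> l))"
        unfolding b_def by (metis (no_types, opaque_lifting) mult.assoc mult.left_commute)
    qed simp
    also have "\<dots> = (\<Sum>j\<in>J. c j * (\<beta> i \<bullet> v j) * (\<beta> i' \<bullet> v j))"
      by (rule sum.reindex_bij_betw[OF \<iota>])
    also have "\<dots> = (\<Sum>j=1..m. c j * (\<beta> i \<bullet> v j) * (\<beta> i' \<bullet> v j))"
      using JI bv0 \<beta>B i by (intro sum.mono_neutral_left) auto
    also have "\<dots> = \<beta> i \<bullet> (\<Sum>j=1..m. c j *\<^sub>R (v j \<bullet> \<beta> i') *\<^sub>R v j)"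
      by (simp add: inner_sum_right inner_commute mult_ac)
    also have "\<dots> = \<beta> i \<bullet> \<beta> i'" using ident[of "\<beta> i'"] by simp
    also have "\<dots> = (if i = i' then 1 else 0)"
    proof -
      have "\<beta> i \<noteq> \<beta> i'" if "i \<noteq> i'" using inj i that by (auto dest: inj_onD)
      then show ?thesis using onB \<beta>B[OF i(1)] \<beta>B[OF i(2)] by (auto simp: pairwise_def orthogonal_def norm_eq_1)
    qed
    finally show ?thesis .
  qed
  have t: "(\<Sum>i<k. (b i l)\<^sup>2) = ct (\<iota> l)" if l: "l < N" for l
  proof -
    have "(\<Sum>i<k. (b i l)\<^sup>2) = (\<Sum>i<k. c (\<iota> l) * (\<beta> i \<bullet> v (\<iota> l))\<^sup>2)"
      using cpos[OF l] by (intro sum.cong) (auto simp: b_def power_mult_distrib)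
    also have "\<dots> = c (\<iota> l) * (\<Sum>x\<in>B. (x \<bullet> v (\<iota> l))\<^sup>2)"
      unfolding sum_distrib_left by (rule sum.reindex_bij_betw[OF \<beta>])
    also have "\<dots> = ct (\<iota> l)" using assms(8) \<iota>J[OF l] nP by simp
    finally show ?thesis .
  qed
  have ctpos: "0 < ct j" if "j \<in> J" for j
    using assms(7,8) that cv(1)[of j] by auto
  let ?P = "\<Pi>\<^sub>M i\<in>{..<k}. (lborel :: real measure)"
  let ?S = "{f \<in> space ?P. \<forall>l<N. \<bar>\<Sum>i<k. f i * b i l\<bar> \<le> a l}"
  have "emeasure ?P ?S \<le> ennreal (2 ^ k * (\<Prod>l<N. slice_factor (a l) (\<Sum>i<k. (b i l)\<^sup>2)))"
  proof (rule slice_bound_every_dim[unfolded slice_bound_def, THEN spec, THEN spec, THEN spec, THEN mp, THEN mp])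
    show "\<forall>i<k. \<forall>i'<k. (\<Sum>l<N. b i l * b i' l) = (if i = i' then 1 else 0)" using on by blast
    show "\<forall>l<N. 0 < a l \<and> 0 < (\<Sum>i<k. (b i l)\<^sup>2)" using t ctpos \<iota>J cpos by (simp add: a_def)
  qed
  also have "(\<Prod>l<N. slice_factor (a l) (\<Sum>i<k. (b i l)\<^sup>2)) = (\<Prod>l<N. slice_factor (sqrt (c (\<iota> l))) (ct (\<iota> l)))"
    using t by (simp add: a_def)
  also have "\<dots> = (\<Prod>j\<in>J. slice_factor (sqrt (c j)) (ct j))"
    by (rule prod.reindex_bij_betw[OF \<iota>])
  also have "\<dots> = (\<Prod>j\<in>J. if ct j = 1 then 1
         else (sinc_integral (1 / (1 - ct j)) / (pi * sqrt (1 - ct j))) powr (1 - ct j)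
              * c j powr (ct j / 2))" (is "_ = ?R")
  proof (rule prod.cong)
    fix j assume j: "j \<in> J"
    then have "0 < c j" using JI cv(1) by auto
    then have "sqrt (c j) powr ct j = c j powr (ct j / 2)"
      by (simp add: powr_half_sqrt[symmetric] powr_powr)
    then show "slice_factor (sqrt (c j)) (ct j) = (if ct j = 1 then 1
         else (sinc_integral (1 / (1 - ct j)) / (pi * sqrt (1 - ct j))) powr (1 - ct j) * c j powr (ct j / 2))"
      using first[OF j] by (simp add: slice_factor_def)
  qed simp
  finally have bound: "emeasure ?P ?S \<le> ennreal (2 ^ k * ?R)" .
  have sm: "(\<lambda>f. \<Sum>i<k. f i *\<^sub>R \<beta> i) \<in> measurable ?P borel" by measurable
  have closed: "K \<inter> H \<in> sets borel"
    using K(2) assms(5) by (intro borel_closed closed_Int closed_subspace compact_imp_closed)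
  have Sm: "?S \<in> sets ?P"
    by measurable
  have "emeasure (subspace_lborel H) (K \<inter> H) = emeasure ?P ((\<lambda>f. \<Sum>i<k. f i *\<^sub>R \<beta> i) -` (K \<inter> H) \<inter> space ?P)"
    unfolding subspace_lborel_eq[OF B] im[symmetric] lborel_onb_indexed[OF finite_lessThan inj]
    by (intro emeasure_distr sm closed)
  also have "\<dots> \<le> emeasure ?P ?S"
  proof (intro emeasure_mono Sm subsetI)
    fix f assume f: "f \<in> (\<lambda>f. \<Sum>i<k. f i *\<^sub>R \<beta> i) -` (K \<inter> H) \<inter> space ?P"
    let ?x = "\<Sum>i<k. f i *\<^sub>R \<beta> i"
    have xK: "?x \<in> K" "- ?x \<in> K" using f K(3) by auto
    have "\<bar>\<Sum>i<k. f i * b i l\<bar> \<le> a l" if l: "l < N" for l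
    proof -
      have m: "\<iota> l \<in> {1..m}" using \<iota>J[OF l] JI by auto
      have "\<bar>v (\<iota> l) \<bullet> ?x\<bar> \<le> 1"
        using contact_point_slab[OF K(1,2,4) cv(3,4)[OF m] xK(1)] contact_point_slab[OF K(1,2,4) cv(3,4)[OF m] xK(2)]
        by (simp add: abs_le_iff)
      moreover have "(\<Sum>i<k. f i * b i l) = sqrt (c (\<iota> l)) * (v (\<iota> l) \<bullet> ?x)"
        unfolding b_def inner_sum_right sum_distrib_left
        by (intro sum.cong) (auto simp: inner_commute mult_ac)
      ultimately show ?thesis
        using cpos[OF l] by (simp add: a_def abs_mult mult_left_le)
    qed
    then show "f \<in> ?S" using f by auto
  qed
  finally have "emeasure (subspace_lborel H) (K \<inter> H) \<le> ennreal (2 ^ k * ?R)" using bound by (rule order_trans)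
  moreover have "0 \<le> 2 ^ k * ?R" by (intro mult_nonneg_nonneg prod_nonneg) auto
  ultimately have "subspace_vol H (K \<inter> H) \<le> 2 ^ k * ?R"
    unfolding subspace_vol_def measure_def by (intro enn2real_leI)
  then show ?thesis using first by (simp add: cube_vol_eq)
qed

end
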